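(* Let $H$ be a real Hilbert space, $A\colon H\to2^H$ a maximal monotone operator with $\operatorname{zer}A\neq\emptyset$, and $M\colon H\to H$ a bounded linear self-adjoint positive semidefinite operator such that $(M+A)^{-1}$ is Lipschitz over $\operatorname{Im}M$ and $J_{M^{-1}A}=(M+A)^{-1}M$ has full domain. Let $s\in(0,2]$, $\alpha>2$, $\theta\in(1,\alpha-1)$, $\sigma>0$, set $T:=(1-s)I+sJ_{M^{-1}A}$, let $u^{-1},u^0\in H$, and let $(u^k)$ be generated by $$u^{k+1}=u^k+\frac{\theta}{k+\sigma}\big(T(u^k)-u^k\big)+\Big(1-\frac{\alpha}{k+\sigma}\Big)\big(T(u^k)-T(u^{k-1})\big),\qquad k\ge0.$$ Then: (i) For all $\bar u\in\operatorname{zer}A$, $$\sum_{k\in\mathbb N}\langle u^k-J_{M^{-1}A}(u^k),J_{M^{-1}A}(u^k)-\bar u\rangle_M<+\infty,\quad\sum_{k\in\mathbb N}k\|u^k-J_{M^{-1}A}(u^k)\|_M^2<+\infty,\quad\sum_{k\in\mathbb N}k\|u^k-u^{k-1}\|_M^2<+\infty.$$ (ii) $(J_{M^{-1}A}(u^k))_{k\in\mathbb N}$ converges weakly to some $u^*\in\operatorname{zer}A$ as $k\to+\infty$. Additionally, if $s=1$, also $(u^k)_{k\in\mathbb N}$ converges weakly to $u^*$. (iii) As $k\to+\infty$, for all $\bar u\in\operatorname{zer}A$, $$\langle u^k-J_{M^{-1}A}(u^k),J_{M^{-1}A}(u^k)-\bar u\rangle_M=o(k^{-1}),\quad\|u^k-u^{k-1}\|_M=o(k^{-1}),\quad\|u^k-J_{M^{-1}A}(u^k)\|_M=o(k^{-1}).$$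 Suppose furthermore that $M$ has closed range and that $M=CC^*$ is an onto decomposition with $C\colon D\to H$. Let $w^k:=C^*u^k\in D$ and $B:=C^*\rhd A$. Then the sequence $(w^k)$ satisfies: (i') for all $\bar w\in\operatorname{zer}B$, $\sum_{k}\langle w^k-J_B(w^k),J_B(w^k)-\bar w\rangle<+\infty$, $\sum_{k}k\|w^k-J_B(w^k)\|^2<+\infty$ and $\sum_{k}k\|w^k-w^{k-1}\|^2<+\infty$; (ii') $(J_B(w^k))_{k\in\mathbb N}$ converges weakly to some $w^*\in\operatorname{zer}B$ and, if $s=1$, also $(w^k)_{k\in\mathbb N}$ converges weakly to $w^*$; (iii') for all $\bar w\in\operatorname{zer}B$, $\langle w^k-J_B(w^k),J_B(w^k)-\bar w\rangle=o(k^{-1})$, $\|w^k-w^{k-1}\|=o(k^{-1})$ and $\|w^k-J_B(w^k)\|=o(k^{-1})$ as $k\to+\infty$; and $w^k\rightharpoonup C^*u^*$ as $k\to+\infty$, where $u^*$ is the weak limit in (ii).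
   Context: For a set-valued operator $A\colon H\to2^H$, $\operatorname{zer}A:=\{u:0\in A(u)\}$; $A$ is maximal monotone if its graph is maximal (for inclusion) among graphs of monotone operators; $A^{-1}$ is the set-valued inverse. The resolvent of $A$ is $J_A:=(I+A)^{-1}$. The operator $M$ may be degenerate ($\ker M\ne\{0\}$); it induces the semi-inner product $\langle u,v\rangle_M:=\langle u,Mv\rangle$ and the seminorm $\|u\|_M:=\sqrt{\langle u,u\rangle_M}$. The operator $M^{-1}A$ is defined by: $v\in M^{-1}A(u)$ if and only if $Mv\in A(u)$; its resolvent is $J_{M^{-1}A}:=(I+M^{-1}A)^{-1}=(M+A)^{-1}M$. "$(M+A)^{-1}$ is Lipschitz over $\operatorname{Im}M$" means there is $L\ge 0$ with $\|v-v'\|\le L\|p-p'\|$ whenever $p,p'\in\operatorname{Im}M$, $v\in(M+A)^{-1}(p)$, $v'\in(M+A)^{-1}(p')$ (so it is single-valued there); hence $J_{M^{-1}A}$ is a single-valued Lipschitz map on $H$. When $M$ has closed range, an onto decomposition $M=CC^*$ consists of a real Hilbert space $D$ and an injective bounded linear operator $C\colon D\to H$ with $M=CC^*$ (in which case $C^*\colon H\to D$ is surjective). The operator $C^*\rhd A\colon D\to2^D$ is $C^*\rhd A:=(C^*A^{-1}C)^{-1}$; it is maximal monotone in this setting, so $J_{C^*\rhd A}$ is single-valued on $D$. Inner products and norms of elements of $D$ are those of $D$. *)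

theory Defs
  imports "HOL-Analysis.Analysis" "HOL-Library.Landau_Symbols"
begin

text \<open>
  A set-valued operator is a function into sets. Throughout, a real Hilbert space is a type of
  sort \<open>{real_inner, complete_space}\<close>.
\<close>

definition op_graph :: "('a \<Rightarrow> 'b set) \<Rightarrow> ('a \<times> 'b) set" where
  "op_graph A = {(u, v). v \<in> A u}"

definition op_inverse :: "('a \<Rightarrow> 'b set) \<Rightarrow> 'b \<Rightarrow> 'a set" where
  "op_inverse A v = {u. v \<in> A u}"

definition zer :: "('a \<Rightarrow> 'b::zero set) \<Rightarrow> 'a set" where
  "zer A = {u. 0 \<in> A u}"

definition monotone_operator :: "('a::real_inner \<Rightarrow> 'a set) \<Rightarrow> bool" where
  "monotone_operator A \<longleftrightarrow>
     (\<forall>(u, v) \<in> op_graph A. \<forall>(u', v') \<in> op_graph A. (u - u') \<bullet> (v - v') \<ge> 0)"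

definition maximal_monotone :: "('a::real_inner \<Rightarrow> 'a set) \<Rightarrow> bool" where
  "maximal_monotone A \<longleftrightarrow> monotone_operator A \<and>
     (\<forall>A'. monotone_operator A' \<and> op_graph A \<subseteq> op_graph A' \<longrightarrow> op_graph A' = op_graph A)"

definition op_plus :: "('a \<Rightarrow> 'b::plus) \<Rightarrow> ('a \<Rightarrow> 'b set) \<Rightarrow> 'a \<Rightarrow> 'b set" where
  "op_plus F A u = (+) (F u) ` A u"

definition resolvent :: "('a::real_vector \<Rightarrow> 'a set) \<Rightarrow> 'a \<Rightarrow> 'a set" where
  "resolvent A = op_inverse (op_plus (\<lambda>u. u) A)"

text \<open>
  The resolvent as a point-to-point map; \<open>resolvent_map A x\<close> is meaningful only where
  \<open>resolvent A x\<close> is a singleton.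
\<close>

definition resolvent_map :: "('a::real_vector \<Rightarrow> 'a set) \<Rightarrow> 'a \<Rightarrow> 'a" where
  "resolvent_map A x = the_elem (resolvent A x)"

text \<open>The operator \<open>M\<^sup>-\<^sup>1 A\<close>, for a map \<open>M\<close> that need not be invertible.\<close>

definition inv_comp :: "('a \<Rightarrow> 'b) \<Rightarrow> ('a \<Rightarrow> 'b set) \<Rightarrow> 'a \<Rightarrow> 'a set" where
  "inv_comp M A u = {v. M v \<in> A u}"

lemma resolvent_inv_comp:
  fixes M :: "'a::real_normed_vector \<Rightarrow> 'a"
  assumes "bounded_linear M"
  shows "resolvent (inv_comp M A) x = op_inverse (op_plus M A) (M x)"
proof -
  interpret bounded_linear M by fact
  have eq: "z \<in> (+) a ` S \<longleftrightarrow> z - a \<in> S" for z a :: 'a and S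
    by (auto simp: image_iff algebra_simps intro: bexI[of _ "z - a"])
  show ?thesis
    by (simp add: resolvent_def op_inverse_def op_plus_def inv_comp_def eq diff)
qed

definition M_inner :: "('a::real_inner \<Rightarrow> 'a) \<Rightarrow> 'a \<Rightarrow> 'a \<Rightarrow> real" where
  "M_inner M u v = u \<bullet> M v"

definition M_seminorm :: "('a::real_inner \<Rightarrow> 'a) \<Rightarrow> 'a \<Rightarrow> real" where
  "M_seminorm M u = sqrt (M_inner M u u)"

definition op_lipschitz_over ::
    "('a::real_normed_vector) set \<Rightarrow> ('a \<Rightarrow> ('b::real_normed_vector) set) \<Rightarrow> bool" where
  "op_lipschitz_over S F \<longleftrightarrow>
     (\<exists>L\<ge>0. \<forall>p\<in>S. \<forall>p'\<in>S. \<forall>v\<in>F p. \<forall>v'\<in>F p'. norm (v - v') \<le> L * norm (p - p'))"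

definition onto_decomposition ::
    "('a::real_inner \<Rightarrow> 'a) \<Rightarrow> ('d::real_inner \<Rightarrow> 'a) \<Rightarrow> bool" where
  "onto_decomposition M C \<longleftrightarrow> bounded_linear C \<and> inj C \<and> M = C \<circ> adjoint C"

text \<open>
  The operator \<open>C\<^sup>* \<rhd> A = (C\<^sup>* A\<^sup>-\<^sup>1 C)\<^sup>-\<^sup>1\<close>; the first argument is \<open>C\<close>, not its adjoint.
\<close>

definition adjoint_postcomp ::
    "('d::real_inner \<Rightarrow> 'a::real_inner) \<Rightarrow> ('a \<Rightarrow> 'a set) \<Rightarrow> 'd \<Rightarrow> 'd set" where
  "adjoint_postcomp C A = op_inverse (\<lambda>d. adjoint C ` op_inverse A (C d))"

text \<open>Weak convergence in a Hilbert space, tested against inner products.\<close>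

definition weakly_converges :: "(nat \<Rightarrow> 'a::real_inner) \<Rightarrow> 'a \<Rightarrow> bool" where
  "weakly_converges x l \<longleftrightarrow> (\<forall>y. (\<lambda>k. x k \<bullet> y) \<longlonglongrightarrow> l \<bullet> y)"

end

theory Submission
  imports Defs
begin

text \<open>
  Everything about the sequence takes place in the seminorm of \<open>M\<close>. There
  \<open>J = J\<^bsub>M\<^sup>-\<^sup>1A\<^esub>\<close> is firmly nonexpansive, its fixed points are the zeros of \<open>A\<close>, and
  \<open>d = u - T u = s (u - J u)\<close> is \<open>1/2\<close>-cocoercive because \<open>s \<le> 2\<close>. Writing
  \<open>v\<^sub>k = u\<^sup>k - u\<^sup>k\<^sup>-\<^sup>1\<close> and \<open>\<tau>\<^sub>k = k + \<sigma> - \<alpha>\<close>, the scheme is a discretisation of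
  \<open>u'' + (\<alpha>/t) u' + d' + (\<theta>/t) d = 0\<close>. For \<open>y\<^sub>k = v\<^sub>k + d\<^sub>k\<^sub>-\<^sub>1\<close> and a zero \<open>z\<close> consider

  \<open>P\<^sub>k = \<tau>\<^sub>k \<langle>u\<^sup>k - z, y\<^sub>k\<rangle> + (\<alpha> - 1)/2 \<parallel>u\<^sup>k - z\<parallel>\<^sup>2\<close> and
  \<open>R\<^sub>k = \<tau>\<^sub>k\<^sup>2/2 (\<eta> \<parallel>y\<^sub>k\<parallel>\<^sup>2 + (1 - \<eta>) \<parallel>v\<^sub>k\<parallel>\<^sup>2)\<close>.

  The increment of \<open>P\<close> can be computed exactly (\<open>anchor_energy_step\<close>), and that of \<open>R\<close> up to terms
  of a favourable sign, one of which is supplied by cocoercivity (\<open>velocity_energy_step\<close>). In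
  \<open>E = \<theta> P + R\<close> the increment is at most \<open>-\<theta>(\<theta> - 1)\<langle>u\<^sup>k - z, d\<^sub>k\<rangle>\<close> minus \<open>\<tau>\<^sub>k\<^sub>+\<^sub>1\<close> times a quadratic
  form in \<open>(v\<^sub>k\<^sub>+\<^sub>1, d\<^sub>k)\<close>, plus a fixed multiple of \<open>\<parallel>v\<^sub>k\<^sub>+\<^sub>1\<parallel>\<^sup>2\<close> that is absorbed once \<open>\<tau>\<close> is large. The
  form is positive definite for small \<open>\<eta> > 0\<close> since \<open>1 < \<theta> < \<alpha> - 1\<close>. For small \<open>\<eta>\<close> the bound
  \<open>\<theta> < \<alpha> - 1\<close> also makes \<open>E\<^sub>k\<close> eventually dominate a multiple of \<open>\<parallel>u\<^sup>k - z\<parallel>\<^sup>2\<close>. Hence \<open>E\<close> converges, all the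
  dissipated quantities are summable, and the iterates are bounded in the seminorm
  (\<open>energy_consequences\<close>).

  The increments of \<open>P\<close> are now summable, so \<open>P\<close> converges, and with it \<open>R = E - \<theta> P\<close>. Since
  \<open>R\<^sub>k / k\<close> is summable, the limit of \<open>R\<close> is zero, which is the \<open>o(1/k)\<close> rate of \<open>v\<^sub>k\<close> and \<open>d\<^sub>k\<close>.
  Inserting this into \<open>P\<close> shows that \<open>\<parallel>u\<^sup>k - z\<parallel>\<close> converges for every zero \<open>z\<close>.

  Weak convergence is an Opial argument adapted to the seminorm (\<open>degenerate_Opial\<close>).
  The Lipschitz condition makes \<open>J\<close> Lipschitz from the seminorm into the norm, so the shadow
  sequence \<open>J u\<^sup>k\<close> is bounded, although the seminorm does not control the norm of \<open>u\<^sup>k\<close>. Its weak cluster points are zeros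
  of \<open>A\<close>, as \<open>M(u\<^sup>k - J u\<^sup>k) \<in> A(J u\<^sup>k)\<close> tends to zero in norm, and two of them have seminorm
  distance zero, hence the same image under \<open>J\<close>, hence are equal. For \<open>s = 1\<close> the iterates are
  weighted averages of the shadow sequence up to a vanishing error
  (\<open>averaging_recursion_tendsto\<close>).

  Finally, if \<open>M = C C\<^sup>*\<close> then \<open>C\<^sup>*\<close> is an isometry from the seminorm of \<open>M\<close> into \<open>D\<close>, it maps
  \<open>zer A\<close> onto \<open>zer (C\<^sup>* \<rhd> A)\<close>, and it intertwines \<open>J\<close> with the resolvent of \<open>C\<^sup>* \<rhd> A\<close>
  (\<open>resolvent_postcomp\<close>). The statements in \<open>D\<close> are therefore images of those in \<open>H\<close>, and since
  \<open>C\<^sup>*(u\<^sup>k - J u\<^sup>k)\<close> tends to zero in norm, \<open>C\<^sup>* u\<^sup>k\<close> has the same weak limit as \<open>C\<^sup>* J u\<^sup>k\<close>.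
\<close>

section \<open>Riesz representation and weak compactness\<close>

lemma linear_coeff_zero_if_quadratic_nonneg:
  fixes a b :: real
  assumes "\<And>t. 0 \<le> t * a + t\<^sup>2 * b"
  shows "a = 0"
proof (cases "b > 0")
  case True
  have "0 \<le> (- a / (2 * b)) * a + (- a / (2 * b))\<^sup>2 * b"
    by (rule assms)
  also have "\<dots> = - a\<^sup>2 / (4 * b)"
    using True by (simp add: field_simps power2_eq_square)
  finally have "a\<^sup>2 \<le> 0"
    using True by (simp add: field_simps)
  then show ?thesis by simp
next
  case False
  with assms[of 1] assms[of "-1"] show ?thesis by simp
qed

text \<open>
  The representing vector minimises the energy \<open>\<parallel>x\<parallel>\<^sup>2/2 - f x\<close>; the parallelogram law makes every
  minimising sequence Cauchy, and the first-order condition at the minimum is the representation.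
\<close>
theorem Riesz_representation:
  fixes f :: "'a::{real_inner, complete_space} \<Rightarrow> real"
  assumes "bounded_linear f"
  obtains p where "\<And>x. f x = p \<bullet> x"
proof -
  interpret f: bounded_linear f by fact
  \<comment> \<open>The energy to be minimised.\<close>
  define \<phi> where "\<phi> x = x \<bullet> x / 2 - f x" for x
  obtain K where K: "\<And>x. \<bar>f x\<bar> \<le> norm x * K"
    using f.bounded by (auto simp: real_norm_def)
  have lower: "- K\<^sup>2 / 2 \<le> \<phi> x" for x
  proof -
    have "0 \<le> (norm x - K)\<^sup>2" by simp
    also have "\<dots> = x \<bullet> x - 2 * (norm x * K) + K\<^sup>2"
      by (simp add: power2_diff power2_norm_eq_inner)
    finally have "2 * (norm x * K) \<le> x \<bullet> x + K\<^sup>2" by simp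
    moreover have "f x \<le> norm x * K" using K[of x] by (simp add: abs_le_iff)
    ultimately show ?thesis
      unfolding \<phi>_def by (simp add: field_simps)
  qed
  define m where "m = Inf (range \<phi>)"
  have m: "m \<le> \<phi> x" for x
    unfolding m_def by (rule cInf_lower) (auto intro!: bdd_belowI2 lower)
  have "\<exists>x. \<phi> x < m + inverse (real (Suc n))" for n
    using cInf_lessD[of "range \<phi>" "m + inverse (real (Suc n))"] by (auto simp: m_def)
  then obtain X where X: "\<And>n. \<phi> (X n) < m + inverse (real (Suc n))"
    by metis
  have par: "\<phi> x + \<phi> y = 2 * \<phi> ((1/2) *\<^sub>R (x + y)) + (norm (x - y))\<^sup>2 / 4" for x y
    unfolding \<phi>_def power2_norm_eq_inner
    by (simp add: f.scaleR f.add inner_simps inner_commute[of y x] field_simps)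
  have close: "(norm (X i - X j))\<^sup>2 \<le> 4 * (inverse (real (Suc i)) + inverse (real (Suc j)))" for i j
  proof -
    define a b where "a = inverse (real (Suc i))" and "b = inverse (real (Suc j))"
    have "\<phi> (X i) < m + a" "\<phi> (X j) < m + b"
      using X by (auto simp: a_def b_def)
    with par[of "X i" "X j"] m[of "(1/2) *\<^sub>R (X i + X j)"] show ?thesis
      unfolding a_def[symmetric] b_def[symmetric] by argo
  qed
  have "Cauchy X"
  proof (rule metric_CauchyI)
    fix e :: real assume e: "e > 0"
    then obtain N where N: "inverse (real (Suc N)) < e\<^sup>2 / 8"
      using reals_Archimedean[of "e\<^sup>2 / 8"] by auto
    have "dist (X i) (X j) < e" if ij: "i \<ge> N" "j \<ge> N" for i j
    proof -
      have "inverse (real (Suc i)) \<le> inverse (real (Suc N))"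
           "inverse (real (Suc j)) \<le> inverse (real (Suc N))"
        using ij by (auto intro!: le_imp_inverse_le)
      with close[of i j] N have "(norm (X i - X j))\<^sup>2 < e\<^sup>2" by argo
      then show ?thesis
        using e by (simp add: dist_norm power_less_imp_less_base)
    qed
    then show "\<exists>N. \<forall>i\<ge>N. \<forall>j\<ge>N. dist (X i) (X j) < e" by blast
  qed
  then obtain p where p: "X \<longlonglongrightarrow> p"
    by (meson Cauchy_convergent convergent_def)
  have "(\<lambda>n. \<phi> (X n)) \<longlonglongrightarrow> \<phi> p"
    unfolding \<phi>_def by (intro tendsto_intros f.tendsto p) auto
  moreover have "(\<lambda>n. m + inverse (real (Suc n))) \<longlonglongrightarrow> m + 0"
    by (intro tendsto_intros LIMSEQ_inverse_real_of_nat)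
  ultimately have "\<phi> p \<le> m"
    using LIMSEQ_le[of "\<lambda>n. \<phi> (X n)" "\<phi> p"] X by (fastforce intro: less_imp_le)
  have "p \<bullet> y - f y = 0" for y
  proof (rule linear_coeff_zero_if_quadratic_nonneg)
    fix t :: real
    have "\<phi> p \<le> \<phi> (p + t *\<^sub>R y)"
      using \<open>\<phi> p \<le> m\<close> m order_trans by blast
    then show "0 \<le> t * (p \<bullet> y - f y) + t\<^sup>2 * (y \<bullet> y / 2)"
      unfolding \<phi>_def
      by (simp add: f.scaleR f.add inner_simps inner_commute[of y p] field_simps power2_eq_square)
  qed
  then show ?thesis by (intro that[of p]) simp
qed

text \<open>The adjoint is a choice of a function; the Riesz representation shows that the choice succeeds.\<close>
lemma adjoint_works_bounded:
  fixes C :: "'d::{real_inner, complete_space} \<Rightarrow> 'h::real_inner"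
  assumes "bounded_linear C"
  shows "C x \<bullet> y = x \<bullet> adjoint C y"
proof -
  have "\<exists>p. \<forall>x. C x \<bullet> y = x \<bullet> p" for y
  proof -
    have "bounded_linear (\<lambda>x. C x \<bullet> y)"
      by (intro bounded_linear_intros assms)
    from Riesz_representation[OF this] show ?thesis
      by (metis inner_commute)
  qed
  then have "\<exists>g. \<forall>x y. C x \<bullet> y = x \<bullet> g y"
    by metis
  then show ?thesis
    unfolding adjoint_def by (rule someI2_ex) blast
qed

text \<open>
  Weak compactness of balls, phrased with filters so that spaces that are not separable are covered.
  By Tychonoff's theorem the functionals \<open>y \<mapsto> x\<^sub>i \<bullet> y\<close> live in a compact product of intervals; a
  cluster point of them is again linear and bounded, hence an inner product with some \<open>p\<close>.
\<close>
theorem bounded_imp_weak_cluster_point: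
  fixes x :: "'i \<Rightarrow> 'a::{real_inner, complete_space}"
  assumes "F \<noteq> bot" and bound: "\<And>i. norm (x i) \<le> R"
  obtains G p where "G \<le> F" "G \<noteq> bot" "\<And>y. ((\<lambda>i. x i \<bullet> y) \<longlongrightarrow> p \<bullet> y) G"
proof -
  define \<Phi> where "\<Phi> i = (\<lambda>y. x i \<bullet> y)" for i
  define K :: "('a \<Rightarrow> real) set" where "K = PiE UNIV (\<lambda>y. {- (R * norm y) .. R * norm y})"
  have "compact K"
  proof -
    have "compactin (product_topology (\<lambda>_::'a. euclidean :: real topology) UNIV) K"
      unfolding K_def compactin_PiE by (simp add: compactin_euclidean_iff)
    then show ?thesis by (simp add: euclidean_product_topology)
  qed
  moreover have "filtermap \<Phi> F \<noteq> bot"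
    using assms(1) by (simp only: filtermap_bot_iff not_False_eq_True)
  moreover have "eventually (\<lambda>g. g \<in> K) (filtermap \<Phi> F)"
  proof -
    have "\<bar>x i \<bullet> y\<bar> \<le> R * norm y" for i y
      using Cauchy_Schwarz_ineq2[of "x i" y] mult_right_mono[OF bound[of i], of "norm y"] by simp
    then have "\<Phi> i \<in> K" for i
      by (auto simp: K_def \<Phi>_def abs_le_iff minus_le_iff)
    then show ?thesis
      by (simp add: eventually_filtermap)
  qed
  ultimately obtain f where f: "f \<in> K" "inf (nhds f) (filtermap \<Phi> F) \<noteq> bot"
    unfolding compact_filter by blast
  \<comment> \<open>The refinement of the index filter along which the functionals converge to \<open>f\<close>.\<close>
  define G where "G = inf F (filtercomap \<Phi> (nhds f))"
  have G: "G \<noteq> bot"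
  proof
    assume "G = bot"
    then have "eventually (\<lambda>_. False) (inf F (filtercomap \<Phi> (nhds f)))"
      by (simp add: G_def)
    then obtain P Q where PQ: "eventually P F" "eventually Q (nhds f)" "\<And>i. P i \<Longrightarrow> Q (\<Phi> i) \<Longrightarrow> False"
      unfolding eventually_inf eventually_filtercomap by blast
    have "eventually (\<lambda>g. \<not> Q g) (filtermap \<Phi> F)"
      unfolding eventually_filtermap using PQ(1) by (rule eventually_mono) (use PQ(3) in blast)
    with PQ(2) have "eventually (\<lambda>_. False) (inf (nhds f) (filtermap \<Phi> F))"
      unfolding eventually_inf by blast
    with f(2) show False by (simp add: eventually_False)
  qed
  have lim: "((\<lambda>i. x i \<bullet> y) \<longlongrightarrow> f y) G" for y
  proof -
    have "(\<Phi> \<longlongrightarrow> f) G"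
      unfolding G_def filterlim_def
      by (meson filtermap_filtercomap filtermap_mono inf_le2 order_trans)
    have "((\<lambda>i. \<Phi> i y) \<longlongrightarrow> f y) G"
    proof (rule topological_tendstoI)
      fix S :: "real set" assume S: "open S" "f y \<in> S"
      have "open ((\<lambda>g :: 'a \<Rightarrow> real. g y) -` S)"
        by (rule open_vimage[OF S(1)]) simp
      from topological_tendstoD[OF \<open>(\<Phi> \<longlongrightarrow> f) G\<close> this]
      show "eventually (\<lambda>i. \<Phi> i y \<in> S) G" using S(2) by simp
    qed
    then show ?thesis by (simp add: \<Phi>_def)
  qed
  have "bounded_linear f"
  proof (rule bounded_linear_intro)
    fix a b
    have "((\<lambda>i. x i \<bullet> a + x i \<bullet> b) \<longlongrightarrow> f a + f b) G"
      by (intro tendsto_intros lim)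
    then show "f (a + b) = f a + f b"
      using tendsto_unique[OF G lim[of "a + b"]] by (simp add: inner_add_right)
  next
    fix r a
    have "((\<lambda>i. r *\<^sub>R (x i \<bullet> a)) \<longlongrightarrow> r *\<^sub>R f a) G"
      by (intro tendsto_intros lim)
    then show "f (r *\<^sub>R a) = r *\<^sub>R f a"
      using tendsto_unique[OF G lim[of "r *\<^sub>R a"]] by simp
  next
    fix a show "norm (f a) \<le> norm a * R"
      using f(1) by (auto simp: K_def PiE_def Pi_def abs_le_iff mult.commute minus_le_iff)
  qed
  then obtain p where "\<And>y. f y = p \<bullet> y"
    using Riesz_representation by blast
  with lim G show ?thesis
    by (intro that[of G p]) (auto simp: G_def)
qed

text \<open>
  If convergence failed when tested against some \<open>y\<close>, the indices witnessing the failure would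
  carry a cluster point different from \<open>p\<close>.
\<close>
lemma weakly_converges_if_unique_cluster_point:
  fixes x :: "nat \<Rightarrow> 'a::{real_inner, complete_space}"
  assumes bound: "\<And>k. norm (x k) \<le> R"
    and unique: "\<And>G q. \<lbrakk>G \<le> sequentially; G \<noteq> bot; \<And>y. ((\<lambda>k. x k \<bullet> y) \<longlongrightarrow> q \<bullet> y) G\<rbrakk> \<Longrightarrow> q = p"
  shows "weakly_converges x p"
  unfolding weakly_converges_def
proof (intro allI tendstoI)
  fix y :: 'a and e :: real assume e: "e > 0"
  show "eventually (\<lambda>k. dist (x k \<bullet> y) (p \<bullet> y) < e) sequentially"
  proof (rule ccontr)
    let ?S = "{k. \<not> dist (x k \<bullet> y) (p \<bullet> y) < e}"
    assume "\<not> ?thesis"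
    then have "inf sequentially (principal ?S) \<noteq> bot"
      by (simp add: trivial_limit_def eventually_inf_principal)
    then obtain G q where
      G: "G \<le> inf sequentially (principal ?S)" "G \<noteq> bot"
      and q: "\<And>y. ((\<lambda>k. x k \<bullet> y) \<longlongrightarrow> q \<bullet> y) G"
      using bounded_imp_weak_cluster_point[of _ x, OF _ bound] by blast
    have "q = p"
      by (rule unique[OF _ G(2) q]) (use G(1) in simp)
    then have "eventually (\<lambda>k. dist (x k \<bullet> y) (p \<bullet> y) < e) G"
      using tendstoD[OF q e] by blast
    moreover have "eventually (\<lambda>k. \<not> dist (x k \<bullet> y) (p \<bullet> y) < e) G"
      using filter_leD[OF G(1)] by (simp add: eventually_inf_principal)
    ultimately have "eventually (\<lambda>_. False) G"
      by eventually_elim simp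
    with G(2) show False by (simp add: eventually_False)
  qed
qed

section \<open>One step of the energy estimate in a semi-inner product\<close>

locale semi_inner_product =
  fixes ip :: "'a::real_vector \<Rightarrow> 'a \<Rightarrow> real"
  assumes commute: "ip x y = ip y x"
    and add_left: "ip (x + y) z = ip x z + ip y z"
    and scaleR_left: "ip (r *\<^sub>R x) y = r * ip x y"
    and nonneg: "0 \<le> ip x x"
begin

lemma add_right: "ip x (y + z) = ip x y + ip x z"
  using add_left commute by metis

lemma scaleR_right: "ip x (r *\<^sub>R y) = r * ip x y"
  using scaleR_left commute by metis

lemma minus_left: "ip (- x) y = - ip x y"
  using scaleR_left[of "-1"] by simp

lemma minus_right: "ip x (- y) = - ip x y"
  using scaleR_right[of _ "-1"] by simp

lemma diff_left: "ip (x - y) z = ip x z - ip y z"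
  unfolding diff_conv_add_uminus add_left minus_left by simp

lemma diff_right: "ip x (y - z) = ip x y - ip x z"
  unfolding diff_conv_add_uminus add_right minus_right by simp

lemma zero_left: "ip 0 y = 0"
  using scaleR_left[of 0] by simp

lemma zero_right: "ip x 0 = 0"
  using scaleR_right[of _ 0] by simp

lemmas expand = add_left add_right scaleR_left scaleR_right minus_left minus_right
  diff_left diff_right zero_left zero_right

abbreviation sq :: "'a \<Rightarrow> real" where "sq x \<equiv> ip x x"

lemma weighted_Young:
  assumes "r > 0"
  shows "\<bar>ip x y\<bar> \<le> (r * sq x + sq y / r) / 2"
proof -
  have "0 \<le> sq (r *\<^sub>R x + y)" "0 \<le> sq (r *\<^sub>R x - y)"
    by (rule nonneg)+
  then have "0 \<le> r * (r * sq x) + 2 * (r * ip x y) + sq y" 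
     "0 \<le> r * (r * sq x) - 2 * (r * ip x y) + sq y" 
    by (simp_all add: expand commute[of y x] algebra_simps)
  then have "2 * r * \<bar>ip x y\<bar> \<le> r * (r * sq x) + sq y"
    by (simp add: abs_if)
  with assms show ?thesis
    by (simp add: field_simps)
qed

lemma Cauchy_Schwarz: "(ip x y)\<^sup>2 \<le> sq x * sq y"
proof (cases "sq y = 0")
  case True
  have "0 \<le> t * (2 * ip x y) + t\<^sup>2 * 0 + sq x" for t
    using nonneg[of "x + t *\<^sub>R y"] True
    by (simp add: expand commute[of y x] algebra_simps)
  from this[of "- (sq x + 1) / (2 * ip x y)"] have "ip x y = 0"
    by (cases "ip x y = 0") auto
  with True show ?thesis by simp
next
  case False
  then have pos: "sq y > 0" using nonneg[of y] by simp
  have "0 \<le> sq (sq y *\<^sub>R x - ip x y *\<^sub>R y)" by (rule nonneg)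
  also have "\<dots> = sq y * (sq x * sq y - (ip x y)\<^sup>2)"
    by (simp add: expand commute[of y x] algebra_simps power2_eq_square)
  finally show ?thesis
    using pos by (simp add: zero_le_mult_iff)
qed

text \<open>
  Here \<open>v, d\<close> stand for \<open>v\<^sub>k, d\<^sub>k\<^sub>-\<^sub>1\<close> and \<open>v', d'\<close> for \<open>v\<^sub>k\<^sub>+\<^sub>1, d\<^sub>k\<close>. The two sides differ by
  three terms of the right sign: two squares, and the cocoercivity gap weighted with \<open>\<tau>\<^sup>2\<close>. This
  gap appears because \<open>\<tau> v\<close> is eliminated through the recursion, which turns \<open>\<langle>v', d' - d\<rangle>\<close> into
  \<open>\<langle>v, d' - d\<rangle>\<close> and leaves exactly half of \<open>\<parallel>d' - d\<parallel>\<^sup>2\<close> to be paid for; a cocoercivity constant of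
  \<open>1/2\<close>, that is \<open>s \<le> 2\<close>, is just enough.
\<close>
lemma velocity_energy_step:
  fixes v v' d d' :: 'a
  assumes rec: "(\<tau> + \<alpha>) *\<^sub>R v' = \<tau> *\<^sub>R (v - (d' - d)) - \<theta> *\<^sub>R d'"
    and coco: "sq (d' - d) / 2 \<le> ip v (d' - d)"
    and \<eta>: "0 \<le> \<eta>" "\<eta> \<le> 1"
  shows "(\<tau> + 1)\<^sup>2 / 2 * (\<eta> * sq (v' + d') + (1 - \<eta>) * sq v')
       - \<tau>\<^sup>2 / 2 * (\<eta> * sq (v + d) + (1 - \<eta>) * sq v)
    \<le> - (\<tau> + 1) * ((\<alpha> - 1) * sq v' + (\<alpha> - 1 + (\<theta> - 1) - (1 - \<eta>) * (\<alpha> - 2)) * ip v' d'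
        + \<eta> * (\<theta> - 1) * sq d')"
proof -
  define w where "w = d' - d"
  define p where "p = (\<tau> + \<alpha>) *\<^sub>R v' + \<tau> *\<^sub>R w + \<theta> *\<^sub>R d'"
  define e where "e = (1 - \<alpha>) *\<^sub>R v' - \<theta> *\<^sub>R d'"
  have p: "\<tau> *\<^sub>R v = p"
    using rec by (simp add: p_def w_def algebra_simps)
  have d: "d = d' - w" by (simp add: w_def)
  have 1: "\<tau>\<^sup>2 * sq v = sq p" "\<tau>\<^sup>2 * ip v w = \<tau> * ip p w"
    unfolding p[symmetric] by (simp_all add: expand power2_eq_square)
  have 2: "\<tau>\<^sup>2 * sq (v + d) = sq (p + \<tau> *\<^sub>R (d' - w))"
    unfolding p[symmetric] d by (simp add: expand power2_eq_square algebra_simps)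
  have coco': "0 \<le> \<tau> * ip p w - \<tau>\<^sup>2 / 2 * sq w"
    using mult_left_mono[OF coco zero_le_power2[of \<tau>]] 1(2) by (simp add: w_def[symmetric])
  have "(\<tau> + 1)\<^sup>2 / 2 * (\<eta> * sq (v' + d') + (1 - \<eta>) * sq v')
       - \<tau>\<^sup>2 / 2 * (\<eta> * sq (v + d) + (1 - \<eta>) * sq v)
     = (\<tau> + 1)\<^sup>2 / 2 * (\<eta> * sq (v' + d') + (1 - \<eta>) * sq v')
       - (\<eta> * sq (p + \<tau> *\<^sub>R (d' - w)) + (1 - \<eta>) * sq p) / 2"
    unfolding 1(1)[symmetric] 2[symmetric] by (simp add: field_simps)
  \<comment> \<open>A polynomial identity in the inner products of \<open>v'\<close>, \<open>d'\<close> and \<open>w\<close>.\<close>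
  also have "\<dots> = - (\<tau> + 1) * ((\<alpha> - 1) * sq v' + (\<alpha> - 1 + (\<theta> - 1) - (1 - \<eta>) * (\<alpha> - 2)) * ip v' d'
        + \<eta> * (\<theta> - 1) * sq d')
     - (1 - \<eta>) * (\<tau> * ip p w - \<tau>\<^sup>2 / 2 * sq w) - \<eta> / 2 * sq (e + d') - (1 - \<eta>) / 2 * sq e"
    unfolding p_def e_def
    by (simp add: expand commute[of d' v'] commute[of w v'] commute[of w d'] field_simps power2_eq_square)
  also have "\<dots> \<le> - (\<tau> + 1) * ((\<alpha> - 1) * sq v' + (\<alpha> - 1 + (\<theta> - 1) - (1 - \<eta>) * (\<alpha> - 2)) * ip v' d'
        + \<eta> * (\<theta> - 1) * sq d')"
    using mult_nonneg_nonneg[OF _ coco', of "1 - \<eta>"] mult_nonneg_nonneg[OF _ nonneg, of "\<eta> / 2" "e + d'"]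
      mult_nonneg_nonneg[OF _ nonneg, of "(1 - \<eta>) / 2" e] \<eta> by simp
  finally show ?thesis .
qed

text \<open>
  The recursion implies \<open>(\<tau> + 1)(v' + d') - \<tau>(v + d) = (1 - \<alpha>) v' - (\<theta> - 1) d'\<close>, and the
  product \<open>(1 - \<alpha>)\<langle>x, v'\<rangle>\<close> arising from it is cancelled by the growth of \<open>(\<alpha> - 1)/2 \<parallel>x\<parallel>\<^sup>2\<close>.
\<close>
lemma anchor_energy_step:
  fixes v v' d d' x :: 'a
  assumes rec: "(\<tau> + \<alpha>) *\<^sub>R v' = \<tau> *\<^sub>R (v - (d' - d)) - \<theta> *\<^sub>R d'"
  shows "((\<tau> + 1) * ip (x + v') (v' + d') + (\<alpha> - 1) / 2 * sq (x + v'))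
       - (\<tau> * ip x (v + d) + (\<alpha> - 1) / 2 * sq x)
    = - (\<theta> - 1) * ip x d' + (\<tau> + 1) * (sq v' + ip v' d') + (\<alpha> - 1) / 2 * sq v'"
proof -
  have y: "\<tau> *\<^sub>R (v + d) = (\<tau> + \<alpha>) *\<^sub>R v' + (\<tau> + \<theta>) *\<^sub>R d'"
    using rec by (simp add: algebra_simps)
  have "\<tau> * ip x (v + d) = (\<tau> + \<alpha>) * ip x v' + (\<tau> + \<theta>) * ip x d'"
    using arg_cong[OF y, of "ip x"] by (simp add: expand)
  then show ?thesis
    by (simp add: expand commute[of d' v'] commute[of v' x] field_simps)
qed

end

section \<open>Real sequences\<close>

lemma decreasing_energy_with_dissipation:
  fixes E F :: "nat \<Rightarrow> real"
  assumes E: "\<And>k. k \<ge> N \<Longrightarrow> 0 \<le> E k" and F: "\<And>k. k \<ge> N \<Longrightarrow> 0 \<le> F k"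
    and step: "\<And>k. k \<ge> N \<Longrightarrow> E (Suc k) + F k \<le> E k"
  shows "convergent E" "summable F"
proof -
  have sum: "(\<Sum>i<n. F (i + N)) \<le> E N - E (n + N)" for n
  proof (induction n)
    case (Suc n)
    then show ?case using step[of "n + N"] by simp
  qed simp
  have "summable (\<lambda>i. F (i + N))"
  proof (rule bounded_imp_summable)
    show "0 \<le> F (n + N)" for n by (rule F) simp
    show "(\<Sum>i\<le>n. F (i + N)) \<le> E N" for n
      using sum[of "Suc n"] E[of "Suc n + N"] by (simp add: lessThan_Suc_atMost)
  qed
  then show "summable F" by (simp add: summable_iff_shift)
  have "decseq (\<lambda>n. E (n + N))"
  proof (rule decseq_SucI)
    fix n show "E (Suc n + N) \<le> E (n + N)"
      using step[of "n + N"] F[of "n + N"] by simp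
  qed
  then obtain L where "(\<lambda>n. E (n + N)) \<longlonglongrightarrow> L"
    by (rule decseq_convergent[of _ 0]) (use E in auto)
  then have "convergent (\<lambda>n. E (n + N))" by (rule convergentI)
  then show "convergent E"
    by (simp add: convergent_ignore_initial_segment)
qed

text \<open>A positive limit would make the summands comparable to the harmonic series.\<close>
lemma weighted_summable_limit_eq_zero:
  fixes R :: "nat \<Rightarrow> real"
  assumes "R \<longlonglongrightarrow> l" and "\<And>k. 0 \<le> R k" and "summable (\<lambda>k. R k / real k)"
  shows "l = 0"
proof (rule ccontr)
  assume "l \<noteq> 0"
  have "l \<ge> 0" using assms(1,2) by (meson LIMSEQ_le_const)
  with \<open>l \<noteq> 0\<close> have l: "l > 0" by simp
  have "eventually (\<lambda>k. R k > l / 2) sequentially"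
    using l by (intro order_tendstoD(1)[OF assms(1)]) simp
  then have "eventually (\<lambda>k. norm (l / 2 * inverse (real k)) \<le> R k / real k) sequentially"
  proof (rule eventually_mono)
    fix k assume "R k > l / 2"
    then have "(l / 2) / real k \<le> R k / real k"
      by (intro divide_right_mono) auto
    moreover have "norm (l / 2 * inverse (real k)) = (l / 2) / real k"
      unfolding divide_inverse[of "l / 2"] real_norm_def using l by (intro abs_of_nonneg) auto
    ultimately show "norm (l / 2 * inverse (real k)) \<le> R k / real k"
      by simp
  qed
  then have "summable (\<lambda>k. l / 2 * inverse (real k))"
    by (rule summable_comparison_test_ev) fact
  then show False
    using l not_summable_harmonic[where 'a = real]
    by (subst (asm) summable_cmult_iff) (simp_all add: inverse_eq_divide)
qed

lemma convergent_if_differences_summable: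
  fixes f :: "nat \<Rightarrow> real"
  assumes "summable (\<lambda>k. f (Suc k) - f k)"
  shows "convergent f"
proof -
  have "convergent (\<lambda>n. \<Sum>k<n. f (Suc k) - f k)"
    using assms by (simp add: summable_iff_convergent)
  then have "convergent (\<lambda>n. f n - f 0)"
    by (simp add: sum_lessThan_telescope)
  then obtain l where "(\<lambda>n. f n - f 0) \<longlonglongrightarrow> l" by (auto simp: convergent_def)
  then have "(\<lambda>n. (f n - f 0) + f 0) \<longlonglongrightarrow> l + f 0"
    by (intro tendsto_intros)
  then show ?thesis by (auto simp: convergent_def)
qed

text \<open>
  Once \<open>b\<close> is within \<open>e/2\<close> of the limit, the excess of \<open>\<bar>x k - l\<bar>\<close> over \<open>e/2\<close> is multiplied by at
  most \<open>1 - \<theta>/(k + \<sigma>) \<le> 1 - 1/(k + \<sigma>)\<close> in each step. The product of these factors telescopes,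
  so the distance is at most \<open>e/2\<close> plus a multiple of \<open>1/(k + \<sigma> - 1)\<close>.
\<close>
lemma averaging_recursion_tendsto:
  fixes x b :: "nat \<Rightarrow> real"
  assumes \<theta>: "1 \<le> \<theta>" and \<sigma>: "0 < \<sigma>"
    and rec: "\<And>k. x (Suc k) = x k + \<theta> / (real k + \<sigma>) * (b k - x k)"
    and b: "b \<longlonglongrightarrow> l"
  shows "x \<longlonglongrightarrow> l"
proof (rule tendstoI)
  fix e :: real assume e: "e > 0"
  \<comment> \<open>The excess of the error over the tolerance; \<open>(k + \<sigma> - 1) g k\<close> will be nonincreasing.\<close>
  define g where "g k = max 0 (\<bar>x k - l\<bar> - e / 2)" for k
  obtain N0 where N0: "\<And>k. k \<ge> N0 \<Longrightarrow> \<bar>b k - l\<bar> < e / 2"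
    using LIMSEQ_D[OF b, of "e / 2"] e by auto
  obtain N1 :: nat where N1: "real N1 > \<theta> + 1" using reals_Archimedean2 by blast
  define N where "N = max N0 N1"
  have step: "(real (Suc k) + \<sigma> - 1) * g (Suc k) \<le> (real k + \<sigma> - 1) * g k" if k: "k \<ge> N" for k
  proof -
    define t where "t = real k + \<sigma>"
    have "real N1 \<le> real k" using k by (simp add: N_def)
    then have t: "t > \<theta>" "t > 1" using N1 \<sigma> \<theta> by (auto simp: t_def)
    have "t * (x (Suc k) - l) = (t - \<theta>) * (x k - l) + \<theta> * (b k - l)"
      unfolding rec[of k] t_def[symmetric] using t \<theta> by (simp add: field_simps)
    then have "\<bar>t * (x (Suc k) - l)\<bar> \<le> \<bar>(t - \<theta>) * (x k - l)\<bar> + \<bar>\<theta> * (b k - l)\<bar>"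
      by simp
    then have "t * \<bar>x (Suc k) - l\<bar> \<le> (t - \<theta>) * \<bar>x k - l\<bar> + \<theta> * \<bar>b k - l\<bar>"
      using t \<theta> by (simp add: abs_mult)
    also have "\<dots> \<le> (t - \<theta>) * (g k + e / 2) + \<theta> * (e / 2)"
      using t \<theta> N0[of k] k e by (intro add_mono mult_left_mono) (auto simp: g_def N_def)
    also have "\<dots> = (t - \<theta>) * g k + t * (e / 2)" by (simp add: field_simps)
    also have "\<dots> \<le> (t - 1) * g k + t * (e / 2)"
      using \<theta> by (intro add_right_mono mult_right_mono) (auto simp: g_def)
    finally have "t * (\<bar>x (Suc k) - l\<bar> - e / 2) \<le> (t - 1) * g k"
      by (simp add: right_diff_distrib)
    moreover have "0 \<le> (t - 1) * g k"
      using t by (intro mult_nonneg_nonneg) (auto simp: g_def)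
    ultimately have "t * g (Suc k) \<le> (t - 1) * g k"
      by (simp add: g_def[of "Suc k"] max_def)
    then show ?thesis by (simp add: t_def add.commute)
  qed
  define C where "C = (real N + \<sigma> - 1) * g N"
  have bound: "(real k + \<sigma> - 1) * g k \<le> C" if "k \<ge> N" for k
    using that by (induction k rule: dec_induct) (use step in \<open>auto simp: C_def intro: order_trans\<close>)
  obtain N2 :: nat where N2: "real N2 > 2 * \<bar>C\<bar> / e + 1" using reals_Archimedean2 by blast
  show "eventually (\<lambda>k. dist (x k) l < e) sequentially"
    using eventually_ge_at_top[of "max N N2"]
  proof eventually_elim
    case (elim k)
    then have k: "k \<ge> N" "real N2 \<le> real k" by auto
    have pos: "real k + \<sigma> - 1 > 2 * \<bar>C\<bar> / e" using N2 k \<sigma> by simp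
    have "g k < e / 2"
    proof (rule ccontr)
      assume "\<not> g k < e / 2"
      moreover have "0 \<le> 2 * \<bar>C\<bar> / e" using e by simp
      ultimately have "2 * \<bar>C\<bar> / e * (e / 2) < (real k + \<sigma> - 1) * g k"
        using pos e by (intro mult_less_le_imp_less) auto
      with bound[OF k(1)] e show False by simp
    qed
    moreover have "\<bar>x k - l\<bar> - e / 2 \<le> g k" by (simp add: g_def)
    ultimately show ?case unfolding dist_real_def by argo
  qed
qed

lemma smallo_inverse_index:
  fixes f :: "nat \<Rightarrow> real"
  assumes "(\<lambda>k. real k * f k) \<longlonglongrightarrow> 0"
  shows "f \<in> o(\<lambda>k. 1 / real k)"
proof (rule smalloI_tendsto)
  show "(\<lambda>k. f k / (1 / real k)) \<longlonglongrightarrow> 0"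
    using assms by (simp add: mult.commute)
  show "eventually (\<lambda>k. 1 / real k \<noteq> 0) sequentially"
    using eventually_gt_at_top[of 0] by eventually_elim simp
qed

lemma smallo_inverse_index_sqrt:
  fixes f :: "nat \<Rightarrow> real"
  assumes "(\<lambda>k. (real k)\<^sup>2 * f k) \<longlonglongrightarrow> 0"
  shows "(\<lambda>k. sqrt (f k)) \<in> o(\<lambda>k. 1 / real k)"
proof (rule smallo_inverse_index)
  show "(\<lambda>k. real k * sqrt (f k)) \<longlonglongrightarrow> 0"
    using tendsto_real_sqrt[OF assms] by (simp add: real_sqrt_mult)
qed

section \<open>Lyapunov analysis of the fast Krasnoselskii-Mann iteration\<close>

text \<open>
  The iteration is indexed by the naturals, with the two starting points \<open>U 0\<close> and \<open>U 1\<close> in the place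
  of \<open>u\<^sup>-\<^sup>1\<close> and \<open>u\<^sup>0\<close>; so \<open>U k\<close> is \<open>u\<^sup>k\<^sup>-\<^sup>1\<close>. The map \<open>T = (1 - s) I + s J\<close> enters in the form
  \<open>x \<mapsto> x - s (x - J x)\<close>.
\<close>
locale fast_Krasnoselskii_Mann = semi_inner_product ip
  for ip :: "'a::real_vector \<Rightarrow> 'a \<Rightarrow> real" +
  fixes J :: "'a \<Rightarrow> 'a" and s \<alpha> \<theta> \<sigma> :: real and U :: "nat \<Rightarrow> 'a"
  assumes firm: "0 \<le> ip (J x - J y) ((x - J x) - (y - J y))"
    and s: "0 < s" "s \<le> 2"
    and \<alpha>: "\<alpha> > 2"
    and \<theta>: "1 < \<theta>" "\<theta> < \<alpha> - 1"
    and \<sigma>: "\<sigma> > 0"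
    and iteration: "U (Suc (Suc k)) = U (Suc k)
         - (\<theta> / (real k + \<sigma>)) *\<^sub>R s *\<^sub>R (U (Suc k) - J (U (Suc k)))
         + (1 - \<alpha> / (real k + \<sigma>)) *\<^sub>R
             ((U (Suc k) - s *\<^sub>R (U (Suc k) - J (U (Suc k)))) - (U k - s *\<^sub>R (U k - J (U k))))"
begin

text \<open>
  Because of the shifted index, \<open>V k\<close> is the velocity \<open>u\<^sup>k - u\<^sup>k\<^sup>-\<^sup>1\<close> and \<open>D k\<close> is the displacement
  \<open>u\<^sup>k\<^sup>-\<^sup>1 - T u\<^sup>k\<^sup>-\<^sup>1\<close> of the previous iterate, so that \<open>V k + D k = u\<^sup>k - T u\<^sup>k\<^sup>-\<^sup>1\<close>.
\<close>
definition V :: "nat \<Rightarrow> 'a" where "V k = U (Suc k) - U k"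

definition D :: "nat \<Rightarrow> 'a" where "D k = s *\<^sub>R (U k - J (U k))"

definition \<tau> :: "nat \<Rightarrow> real" where "\<tau> k = real k + \<sigma> - \<alpha>"

lemma \<tau>_Suc: "\<tau> (Suc k) = \<tau> k + 1"
  by (simp add: \<tau>_def)

lemma velocity_recursion:
  "(\<tau> k + \<alpha>) *\<^sub>R V (Suc k) = \<tau> k *\<^sub>R (V k - (D (Suc k) - D k)) - \<theta> *\<^sub>R D (Suc k)"
proof -
  define t where "t = real k + \<sigma>"
  have t: "t > 0" using \<sigma> by (simp add: t_def)
  have "V (Suc k) = (1 - \<alpha> / t) *\<^sub>R (V k - (D (Suc k) - D k)) - (\<theta> / t) *\<^sub>R D (Suc k)"
    unfolding V_def D_def iteration[of k] t_def by (simp add: algebra_simps)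
  then have "t *\<^sub>R V (Suc k) = (t * (1 - \<alpha> / t)) *\<^sub>R (V k - (D (Suc k) - D k)) - (t * (\<theta> / t)) *\<^sub>R D (Suc k)"
    by (simp only: scaleR_diff_right[of t] scaleR_scaleR)
  moreover have "t * (1 - \<alpha> / t) = \<tau> k" "t * (\<theta> / t) = \<theta>" "t = \<tau> k + \<alpha>"
    using t by (simp_all add: \<tau>_def t_def field_simps)
  ultimately show ?thesis by simp
qed

lemma residual_firm:
  "sq ((x - J x) - (y - J y)) \<le> ip (x - y) ((x - J x) - (y - J y))"
proof -
  have "x - y = (J x - J y) + ((x - J x) - (y - J y))" by simp
  then have "ip (x - y) ((x - J x) - (y - J y))
    = ip (J x - J y) ((x - J x) - (y - J y)) + sq ((x - J x) - (y - J y))"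
    by (metis add_left)
  with firm[of x y] show ?thesis by simp
qed

text \<open>\<open>I - J\<close> is firmly nonexpansive, so \<open>s (I - J)\<close> is \<open>1/s\<close>-cocoercive, and \<open>1/s \<ge> 1/2\<close>.\<close>
lemma residual_cocoercive:
  fixes x y :: 'a
  defines "w \<equiv> s *\<^sub>R (x - J x) - s *\<^sub>R (y - J y)"
  shows "sq w / 2 \<le> ip (x - y) w"
proof -
  define q where "q = (x - J x) - (y - J y)"
  have w: "w = s *\<^sub>R q" by (simp add: w_def q_def algebra_simps)
  have "s / 2 * sq q \<le> 1 * sq q"
    using s nonneg by (intro mult_right_mono) auto
  also have "\<dots> \<le> ip (x - y) q"
    using residual_firm by (simp add: q_def)
  finally have "s * (s / 2 * sq q) \<le> s * ip (x - y) q"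
    using s by (intro mult_left_mono) auto
  then show ?thesis
    by (simp add: w expand)
qed

lemma D_cocoercive_along_V: "sq (D (Suc k) - D k) / 2 \<le> ip (V k) (D (Suc k) - D k)"
  unfolding V_def D_def by (rule residual_cocoercive)

lemma D_cocoercive_fixpoint:
  assumes "J z = z"
  shows "sq (D k) / 2 \<le> ip (U k - z) (D k)"
  using residual_cocoercive[of "U k" z] assms by (simp add: D_def)

definition anchor_energy :: "'a \<Rightarrow> nat \<Rightarrow> real" where
  "anchor_energy z k = \<tau> k * ip (U (Suc k) - z) (V k + D k) + (\<alpha> - 1) / 2 * sq (U (Suc k) - z)"

definition velocity_energy :: "real \<Rightarrow> nat \<Rightarrow> real" where
  "velocity_energy \<eta> k = (\<tau> k)\<^sup>2 / 2 * (\<eta> * sq (V k + D k) + (1 - \<eta>) * sq (V k))"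

lemma anchor_energy_Suc:
  "anchor_energy z (Suc k) - anchor_energy z k
    = - (\<theta> - 1) * ip (U (Suc k) - z) (D (Suc k))
      + \<tau> (Suc k) * (sq (V (Suc k)) + ip (V (Suc k)) (D (Suc k))) + (\<alpha> - 1) / 2 * sq (V (Suc k))"
proof -
  have eq: "U (Suc (Suc k)) - z = (U (Suc k) - z) + V (Suc k)" by (simp add: V_def)
  show ?thesis
    unfolding anchor_energy_def \<tau>_Suc eq by (rule anchor_energy_step[OF velocity_recursion])
qed

lemma velocity_energy_Suc:
  assumes "0 \<le> \<eta>" "\<eta> \<le> 1"
  shows "velocity_energy \<eta> (Suc k) - velocity_energy \<eta> k
    \<le> - \<tau> (Suc k) * ((\<alpha> - 1) * sq (V (Suc k))
        + (\<alpha> - 1 + (\<theta> - 1) - (1 - \<eta>) * (\<alpha> - 2)) * ip (V (Suc k)) (D (Suc k))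
        + \<eta> * (\<theta> - 1) * sq (D (Suc k)))"
  using velocity_energy_step[OF velocity_recursion D_cocoercive_along_V assms]
  unfolding velocity_energy_def \<tau>_Suc by simp

text \<open>
  The factor \<open>\<theta>\<close> in front of the anchor energy makes the coefficient of the mixed term
  \<open>\<langle>v, d\<rangle>\<close> equal to \<open>\<eta> (\<alpha> - 2)\<close>, which can be made as small as desired.
\<close>
lemma energy_Suc:
  assumes "0 \<le> \<eta>" "\<eta> \<le> 1"
  shows "\<theta> * anchor_energy z (Suc k) + velocity_energy \<eta> (Suc k)
      + \<theta> * (\<theta> - 1) * ip (U (Suc k) - z) (D (Suc k))
      + \<tau> (Suc k) * ((\<alpha> - 1 - \<theta>) * sq (V (Suc k)) + \<eta> * (\<alpha> - 2) * ip (V (Suc k)) (D (Suc k))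
          + \<eta> * (\<theta> - 1) * sq (D (Suc k)))
    \<le> \<theta> * anchor_energy z k + velocity_energy \<eta> k + \<theta> * (\<alpha> - 1) * sq (V (Suc k)) / 2"
  using velocity_energy_Suc[OF assms, of k]
    arg_cong[OF anchor_energy_Suc[of z k], of "\<lambda>x. \<theta> * x"]
  by (simp add: algebra_simps)

text \<open>
  The only term without a sign is \<open>\<theta> \<tau> \<langle>u - z, v\<rangle>\<close>. Young's inequality with weight \<open>m\<close> splits it
  between \<open>(\<alpha> - 1)/2 \<parallel>u - z\<parallel>\<^sup>2\<close>, which survives if \<open>m < \<alpha> - 1\<close>, and \<open>(1 - \<eta>) \<tau>\<^sup>2/2 \<parallel>v\<parallel>\<^sup>2\<close>,
  which is large enough if \<open>\<theta> < (1 - \<eta>) m\<close> and \<open>\<tau>\<close> is large.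
\<close>
lemma energy_lower_bound:
  assumes z: "J z = z" and \<eta>: "0 \<le> \<eta>" 
    and m: "0 < m"  and \<tau>: "0 < \<tau> k" "\<theta> / m + \<theta> / \<tau> k \<le> 1 - \<eta>"
  shows "\<theta> / 2 * (\<alpha> - 1 - m) * sq (U (Suc k) - z) \<le> \<theta> * anchor_energy z k + velocity_energy \<eta> k"
proof -
  define x where "x = U (Suc k) - z"
  have "0 \<le> ip (x - V k) (D k) - sq (D k) / 2"
    using D_cocoercive_fixpoint[OF z, of k] by (simp add: x_def V_def)
  then have 1: "ip x (V k) - sq (V k) / 2 \<le> ip x (V k + D k)"
    using nonneg[of "V k + D k"] by (simp add: expand commute[of "D k" "V k"])
  have "\<bar>ip x (\<tau> k *\<^sub>R V k)\<bar> \<le> (m * sq x + sq (\<tau> k *\<^sub>R V k) / m) / 2"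
    using m by (rule weighted_Young)
  then have 2: "- (m * sq x + (\<tau> k)\<^sup>2 * sq (V k) / m) / 2 \<le> \<tau> k * ip x (V k)"
    by (simp add: expand power2_eq_square abs_le_iff mult.assoc)
  have "\<theta> * (- (m * sq x + (\<tau> k)\<^sup>2 * sq (V k) / m) / 2 - \<tau> k * sq (V k) / 2)
      \<le> \<theta> * (\<tau> k * ip x (V k + D k))"
    using 2 mult_left_mono[OF 1, of "\<tau> k"] \<tau>(1) \<theta> by (intro mult_left_mono) (auto simp: algebra_simps)
  moreover have "\<theta> * ((\<tau> k)\<^sup>2 * sq (V k) / m) + \<theta> * (\<tau> k * sq (V k)) \<le> (1 - \<eta>) * ((\<tau> k)\<^sup>2 * sq (V k))"
  proof -
    have "\<theta> * ((\<tau> k)\<^sup>2 * sq (V k) / m) + \<theta> * (\<tau> k * sq (V k))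
        = (\<theta> / m + \<theta> / \<tau> k) * ((\<tau> k)\<^sup>2 * sq (V k))"
      using \<tau>(1) m by (simp add: field_simps power2_eq_square)
    also have "\<dots> \<le> (1 - \<eta>) * ((\<tau> k)\<^sup>2 * sq (V k))"
      using \<tau>(2) nonneg by (intro mult_right_mono) auto
    finally show ?thesis .
  qed
  moreover have "0 \<le> \<eta> * ((\<tau> k)\<^sup>2 * sq (V k + D k))"
    using \<eta> nonneg by simp
  moreover define a where "a = (\<tau> k)\<^sup>2 * sq (V k)"
  moreover define c where "c = \<theta> * (a / m)"
  moreover define g where "g = \<theta> * (\<tau> k * ip x (V k + D k))"
  moreover define e where "e = \<eta> * ((\<tau> k)\<^sup>2 * sq (V k + D k))"
  moreover define h where "h = \<theta> * (\<tau> k * sq (V k))"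
  moreover define r where "r = (1 - \<eta>) * a"
  moreover define q where "q = \<theta> * (m * sq x)"
  ultimately have "- q / 2 - c / 2 - h / 2 \<le> g" "c + h \<le> r" "0 \<le> e"
    by (simp_all add: field_simps)
  then have "- q / 2 \<le> g + (e + r) / 2"
    by argo
  moreover have "\<theta> * anchor_energy z k + velocity_energy \<eta> k
      = g + \<theta> * (\<alpha> - 1) / 2 * sq x + (e + r) / 2"
    unfolding anchor_energy_def velocity_energy_def x_def[symmetric] g_def a_def e_def r_def
    by (simp add: field_simps)
  ultimately show ?thesis
    unfolding x_def[symmetric] q_def by (simp add: field_simps)
qed

text \<open>
  A common choice of parameters for the decrease and for the lower bound of the energy.
  The room for both is the gap \<open>1 < \<theta> < \<alpha> - 1\<close>.
\<close>
lemma quadratic_dissipation: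
  obtains \<eta> \<delta> m where "0 < \<eta>" "\<eta> < 1" "0 < \<delta>" "0 < m" "m < \<alpha> - 1" "\<theta> / m < 1 - \<eta>"
    "\<And>v d. \<delta> * (sq v + sq d) \<le> (\<alpha> - 1 - \<theta>) * sq v + \<eta> * (\<alpha> - 2) * ip v d + \<eta> * (\<theta> - 1) * sq d"
proof -
  \<comment> \<open>In these terms \<open>\<alpha> - 1 - \<theta> = c - b\<close>. Young's inequality with weight \<open>c/b\<close> takes exactly half
      of \<open>\<eta> b \<parallel>d\<parallel>\<^sup>2\<close>, and \<open>\<eta>\<close> is chosen such that it takes at most half of \<open>(c - b) \<parallel>v\<parallel>\<^sup>2\<close>.\<close>
  define b c where "b = \<theta> - 1" and "c = \<alpha> - 2"
  have bc: "0 < b" "b < c" using \<theta> by (auto simp: b_def c_def)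
  define m where "m = (\<theta> + \<alpha> - 1) / 2"
  have m: "\<theta> < m" "m < \<alpha> - 1" using \<theta> by (auto simp: m_def)
  define \<eta> where "\<eta> = min (b * (c - b) / c\<^sup>2) ((1 - \<theta> / m) / 2)"
  have "0 < 1 - \<theta> / m" "\<theta> / m > 0" using m \<theta> by (auto simp: field_simps)
  moreover from this have "0 < \<eta>"
    using bc by (simp add: \<eta>_def)
  moreover have "\<eta> \<le> (1 - \<theta> / m) / 2"
    unfolding \<eta>_def by (rule min.cobounded2)
  ultimately have \<eta>: "0 < \<eta>" "\<eta> < 1" "\<theta> / m < 1 - \<eta>"
    by auto
  have "\<eta> \<le> b * (c - b) / c\<^sup>2" by (simp add: \<eta>_def)
  then have \<eta>c: "\<eta> * c * (c / b) \<le> c - b"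
    using bc by (simp add: field_simps power2_eq_square)
  define \<delta> where "\<delta> = min ((c - b) / 2) (\<eta> * b / 2)"
  have \<delta>: "0 < \<delta>" "\<delta> \<le> (c - b) / 2" "\<delta> \<le> \<eta> * b / 2"
    unfolding \<delta>_def using bc \<eta> by (simp_all only: min.cobounded1 min.cobounded2) simp
  have "\<delta> * (sq v + sq d) \<le> (c - b) * sq v + \<eta> * c * ip v d + \<eta> * b * sq d" for v d
  proof -
    have "- (c / b * sq v + sq d / (c / b)) / 2 \<le> ip v d"
      using weighted_Young[of "c / b" v d] bc by (simp add: abs_le_iff)
    then have "\<eta> * c * (- (c / b * sq v + sq d / (c / b)) / 2) \<le> \<eta> * c * ip v d"
      using \<eta> bc by (intro mult_left_mono) auto
    moreover have "\<eta> * c * (- (c / b * sq v + sq d / (c / b)) / 2) = - (\<eta> * c * (c / b) * sq v) / 2 - \<eta> * b * sq d / 2"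
      using bc by (simp add: field_simps)
    ultimately have "- (\<eta> * c * (c / b) * sq v) / 2 - \<eta> * b * sq d / 2 \<le> \<eta> * c * ip v d"
      by (simp only:)
    moreover have "\<eta> * c * (c / b) * sq v \<le> (c - b) * sq v"
      using \<eta>c nonneg by (rule mult_right_mono)
    moreover have "\<delta> * sq v \<le> (c - b) * sq v / 2"
      using mult_right_mono[OF \<delta>(2) nonneg[of v]] by simp
    moreover have "\<delta> * sq d \<le> \<eta> * b * sq d / 2"
      using mult_right_mono[OF \<delta>(3) nonneg[of d]] by simp
    moreover have "x + y \<le> a + e + f" if "- h / 2 - f / 2 \<le> e" "h \<le> a" "x \<le> a / 2" "y \<le> f / 2"
      for x y a e f h :: real
      using that by argo
    ultimately show ?thesis
      unfolding distrib_left by blast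
  qed
  then show ?thesis
    using \<eta> \<delta> m \<theta> by (intro that[of \<eta> \<delta> m]) (auto simp: b_def c_def algebra_simps)
qed

lemma eventually_\<tau>_gt: "eventually (\<lambda>k. \<tau> k > B) sequentially"
  using eventually_gt_at_top[of "nat \<lceil>B + \<alpha> - \<sigma>\<rceil>"] by (rule eventually_mono) (simp add: \<tau>_def, linarith)

text \<open>
  For \<open>\<tau>\<close> large, half of the dissipation absorbs the remainder \<open>\<theta>(\<alpha> - 1)/2 \<parallel>v\<parallel>\<^sup>2\<close> left over in
  the increment of the anchor energy. The constants are independent of the fixed point.
\<close>
lemma energy_dissipation:
  obtains \<eta> \<delta> \<epsilon> N where "0 < \<eta>" "\<eta> < 1" "0 < \<delta>" "0 < \<epsilon>"
    "\<And>k. k \<ge> N \<Longrightarrow> 1 \<le> \<tau> k"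
    "\<And>k z. k \<ge> N \<Longrightarrow> J z = z \<Longrightarrow> \<epsilon> * sq (U (Suc k) - z) \<le> \<theta> * anchor_energy z k + velocity_energy \<eta> k"
    "\<And>k z. k \<ge> N \<Longrightarrow>
        \<theta> * anchor_energy z (Suc k) + velocity_energy \<eta> (Suc k)
        + (\<theta> * (\<theta> - 1) * ip (U (Suc k) - z) (D (Suc k))
          + \<delta> * \<tau> (Suc k) * (sq (V (Suc k)) + sq (D (Suc k))))
        \<le> \<theta> * anchor_energy z k + velocity_energy \<eta> k"
proof -
  obtain \<eta> \<delta> m where \<eta>: "0 < \<eta>" "\<eta> < 1" and \<delta>: "0 < \<delta>" and m: "0 < m" "m < \<alpha> - 1" "\<theta> / m < 1 - \<eta>"
    and Q: "\<And>v d. \<delta> * (sq v + sq d) \<le> (\<alpha> - 1 - \<theta>) * sq v + \<eta> * (\<alpha> - 2) * ip v d + \<eta> * (\<theta> - 1) * sq d"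
    using quadratic_dissipation by blast
  \<comment> \<open>The second entry is for the lower bound of the energy, the third one for absorbing the remainder.\<close>
  define B where "B = max 1 (max (\<theta> / (1 - \<eta> - \<theta> / m)) (\<theta> * (\<alpha> - 1) / \<delta>))"
  obtain N where N: "\<And>k. k \<ge> N \<Longrightarrow> \<tau> k > B"
    using eventually_\<tau>_gt[of B] unfolding eventually_sequentially by blast
  show ?thesis
  proof (rule that[of \<eta> "\<delta> / 2" "\<theta> / 2 * (\<alpha> - 1 - m)" N])
    show "1 \<le> \<tau> k" if "k \<ge> N" for k using N[OF that] by (simp add: B_def)
    fix k z assume "k \<ge> N"
    note \<tau> = N[OF this]
    have 1: "\<tau> k > 1" "\<theta> / (1 - \<eta> - \<theta> / m) < \<tau> k" "\<theta> * (\<alpha> - 1) / \<delta> < \<tau> k"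
      using \<tau> by (auto simp: B_def)
    have "\<theta> < \<tau> k * (1 - \<eta> - \<theta> / m)"
      using 1(2) m(3) by (subst (asm) pos_divide_less_eq) auto
    then have "\<theta> / \<tau> k < 1 - \<eta> - \<theta> / m"
      using 1(1) by (subst pos_divide_less_eq) (auto simp: mult.commute)
    then show "\<theta> / 2 * (\<alpha> - 1 - m) * sq (U (Suc k) - z) \<le> \<theta> * anchor_energy z k + velocity_energy \<eta> k"
      if "J z = z"
      using that \<eta> m 1(1) by (intro energy_lower_bound) auto
    have "\<theta> * (\<alpha> - 1) \<le> \<delta> * \<tau> (Suc k)"
      using 1(3) \<delta> by (simp add: \<tau>_Suc field_simps)
    then have "\<theta> * (\<alpha> - 1) * sq (V (Suc k)) \<le> \<delta> * \<tau> (Suc k) * sq (V (Suc k))"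
      using nonneg by (rule mult_right_mono)
    moreover have "0 \<le> \<delta> * \<tau> (Suc k) * sq (D (Suc k))"
      using 1 \<delta> nonneg by (simp add: \<tau>_Suc)
    moreover define Q where "Q = \<tau> (Suc k) *
      ((\<alpha> - 1 - \<theta>) * sq (V (Suc k)) + \<eta> * (\<alpha> - 2) * ip (V (Suc k)) (D (Suc k)) + \<eta> * (\<theta> - 1) * sq (D (Suc k)))"
    have "\<tau> (Suc k) * (\<delta> * (sq (V (Suc k)) + sq (D (Suc k)))) \<le> Q"
      unfolding Q_def using 1 by (intro mult_left_mono Q) (auto simp: \<tau>_Suc)
    then have "\<delta> * \<tau> (Suc k) * sq (V (Suc k)) + \<delta> * \<tau> (Suc k) * sq (D (Suc k)) \<le> Q"
      by (simp add: algebra_simps)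
    ultimately have *: "\<delta> * \<tau> (Suc k) * sq (V (Suc k)) / 2 + \<delta> * \<tau> (Suc k) * sq (D (Suc k)) / 2
        + \<theta> * (\<alpha> - 1) * sq (V (Suc k)) / 2 \<le> Q"
      by linarith
    have "\<delta> / 2 * \<tau> (Suc k) * (sq (V (Suc k)) + sq (D (Suc k)))
         = \<delta> * \<tau> (Suc k) * sq (V (Suc k)) / 2 + \<delta> * \<tau> (Suc k) * sq (D (Suc k)) / 2"
      by (simp add: field_simps)
    with * have "\<delta> / 2 * \<tau> (Suc k) * (sq (V (Suc k)) + sq (D (Suc k)))
        + \<theta> * (\<alpha> - 1) * sq (V (Suc k)) / 2 \<le> Q"
      by (simp only:)
    moreover have "E1 + (G + W) \<le> E0" if "W + P \<le> Q" "E1 + G + Q \<le> E0 + P" for E1 E0 G Q P W :: real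
      using that by argo
    ultimately show "\<theta> * anchor_energy z (Suc k) + velocity_energy \<eta> (Suc k)
        + (\<theta> * (\<theta> - 1) * ip (U (Suc k) - z) (D (Suc k))
          + \<delta> / 2 * \<tau> (Suc k) * (sq (V (Suc k)) + sq (D (Suc k))))
        \<le> \<theta> * anchor_energy z k + velocity_energy \<eta> k"
      using energy_Suc[of \<eta> z k, folded Q_def] \<eta> by simp
  qed (use \<eta> \<delta> m \<theta> in auto)
qed

lemma eventually_index_le_\<tau>: "eventually (\<lambda>k. 0 < \<tau> k \<and> real k \<le> 2 * \<tau> k \<and> \<tau> k \<le> 2 * real k) sequentially"
  using eventually_\<tau>_gt[of "2 * \<bar>\<sigma> - \<alpha>\<bar>"]
  by (rule eventually_mono) (auto simp: \<tau>_def abs_if split: if_splits)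

lemma energy_consequences:
  assumes z: "J z = z"
  obtains \<eta> where "0 < \<eta>" "\<eta> < 1"
    "convergent (\<lambda>k. \<theta> * anchor_energy z k + velocity_energy \<eta> k)"
    "summable (\<lambda>k. ip (U (Suc k) - z) (D (Suc k)))"
    "summable (\<lambda>k. \<tau> k * (sq (V k) + sq (D k)))"
    "Bseq (\<lambda>k. sq (U (Suc k) - z))"
proof -
  obtain \<eta> \<delta> \<epsilon> N where \<eta>: "0 < \<eta>" "\<eta> < 1" and pos: "0 < \<delta>" "0 < \<epsilon>"
    and N: "\<And>k. k \<ge> N \<Longrightarrow> 1 \<le> \<tau> k"
    and lower: "\<And>k. k \<ge> N \<Longrightarrow> \<epsilon> * sq (U (Suc k) - z) \<le> \<theta> * anchor_energy z k + velocity_energy \<eta> k"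
    and step: "\<And>k. k \<ge> N \<Longrightarrow>
        \<theta> * anchor_energy z (Suc k) + velocity_energy \<eta> (Suc k)
        + (\<theta> * (\<theta> - 1) * ip (U (Suc k) - z) (D (Suc k))
          + \<delta> * \<tau> (Suc k) * (sq (V (Suc k)) + sq (D (Suc k))))
        \<le> \<theta> * anchor_energy z k + velocity_energy \<eta> k"
    using energy_dissipation z by metis
  define E where "E k = \<theta> * anchor_energy z k + velocity_energy \<eta> k" for k
  define G where "G k = \<theta> * (\<theta> - 1) * ip (U (Suc k) - z) (D (Suc k))" for k
  define S where "S k = \<tau> k * (sq (V k) + sq (D k))" for k
  have G: "0 \<le> G k" for k
  proof -
    have "0 \<le> ip (U (Suc k) - z) (D (Suc k))"
      using D_cocoercive_fixpoint[OF z, of "Suc k"] nonneg[of "D (Suc k)"] by simp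
    then show ?thesis using \<theta> by (simp add: G_def)
  qed
  have S: "0 \<le> S k" if "k \<ge> N" for k
    using N[OF that] nonneg by (simp add: S_def add_nonneg_nonneg)
  have E: "0 \<le> E k" if "k \<ge> N" for k
    using lower[OF that] mult_nonneg_nonneg[of \<epsilon>, OF _ nonneg[of "U (Suc k) - z"]] pos
    by (simp add: E_def)
  have GS: "0 \<le> G k + \<delta> * S (Suc k)" if "k \<ge> N" for k
    using G[of k] S[of "Suc k"] pos that by simp
  have EGS: "E (Suc k) + (G k + \<delta> * S (Suc k)) \<le> E k" if "k \<ge> N" for k
    using step[OF that] by (simp add: E_def G_def S_def mult.assoc)
  note lim = decreasing_energy_with_dissipation[of N E, OF E GS EGS]
  have "summable G"
  proof (rule summable_comparison_test_ev[OF _ lim(2)])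
    show "eventually (\<lambda>k. norm (G k) \<le> G k + \<delta> * S (Suc k)) sequentially"
      using eventually_ge_at_top[of N] by (rule eventually_mono) (use G S pos in simp)
  qed
  then have 1: "summable (\<lambda>k. ip (U (Suc k) - z) (D (Suc k)))"
    unfolding G_def using \<theta> by (subst (asm) summable_cmult_iff) auto
  have "summable (\<lambda>k. \<delta> * S (Suc k))"
  proof (rule summable_comparison_test_ev[OF _ lim(2)])
    show "eventually (\<lambda>k. norm (\<delta> * S (Suc k)) \<le> G k + \<delta> * S (Suc k)) sequentially"
      using eventually_ge_at_top[of N] by (rule eventually_mono) (use G S pos in simp)
  qed
  then have "summable (\<lambda>k. S (Suc k))"
    using pos by (subst (asm) summable_cmult_iff) auto
  then have 2: "summable S" by (simp only: summable_Suc_iff)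
  have "Bseq E"
    using lim(1) by (rule convergent_imp_Bseq)
  then have "Bseq (\<lambda>k. E k / \<epsilon>)"
    using Bseq_cmult_iff[of "1 / \<epsilon>" E] pos by simp
  then have "Bseq (\<lambda>k. sq (U (Suc k) - z))"
  proof (rule Bseq_eventually_mono[rotated])
    show "eventually (\<lambda>k. norm (sq (U (Suc k) - z)) \<le> norm (E k / \<epsilon>)) sequentially"
      using eventually_ge_at_top[of N]
    proof (rule eventually_mono)
      fix k assume k: "N \<le> k"
      have "sq (U (Suc k) - z) \<le> E k / \<epsilon>"
        using lower[OF k] pos by (simp add: E_def pos_le_divide_eq mult.commute)
      then show "norm (sq (U (Suc k) - z)) \<le> norm (E k / \<epsilon>)"
        using nonneg[of "U (Suc k) - z"] unfolding real_norm_def by linarith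
    qed
  qed
  with \<eta> lim(1) 1 2 show ?thesis
    by (intro that[of \<eta>]) (auto simp: E_def[abs_def] S_def[abs_def])
qed

lemma abs_ip_le: "\<bar>ip x y\<bar> \<le> sq x + sq y"
  using weighted_Young[of 1 x y] nonneg[of x] nonneg[of y] by simp

text \<open>
  Each of these sequences is eventually bounded by a multiple of the dissipated quantity
  \<open>\<tau> (\<parallel>v\<parallel>\<^sup>2 + \<parallel>d\<parallel>\<^sup>2)\<close>, because \<open>\<tau>\<close> and the index are comparable.
\<close>
lemma summable_velocity_residual:
  assumes z: "J z = z"
  shows "summable (\<lambda>k. \<tau> k * sq (V k))"
    "summable (\<lambda>k. \<tau> k * ip (V k) (D k))"
    "summable (\<lambda>k. real k * sq (V k))" "summable (\<lambda>k. real k * sq (D k))"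
    "summable (\<lambda>k. sq (V k))"
proof -
  have sum: "summable (\<lambda>k. \<tau> k * (sq (V k) + sq (D k)))"
    using energy_consequences[OF z] by metis
  have dom: "summable f" if "\<And>k. k \<ge> 1 \<Longrightarrow> 0 < \<tau> k \<Longrightarrow> real k \<le> 2 * \<tau> k \<Longrightarrow> \<bar>f k\<bar> \<le> 2 * (\<tau> k * (sq (V k) + sq (D k)))" for f
  proof (rule summable_comparison_test_ev)
    show "summable (\<lambda>k. 2 * (\<tau> k * (sq (V k) + sq (D k))))"
      using sum by (rule summable_mult)
    show "eventually (\<lambda>k. norm (f k) \<le> 2 * (\<tau> k * (sq (V k) + sq (D k)))) sequentially"
      using eventually_index_le_\<tau> eventually_ge_at_top[of 1]
      by eventually_elim (use that in simp)
  qed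
  have le: "\<bar>c * x\<bar> \<le> 2 * (t * (a + b))" if "0 \<le> c" "c \<le> 2 * t" "\<bar>x\<bar> \<le> a + b" for c x t a b :: real
    using mult_mono[OF that(2,3)] that by (simp add: abs_mult)
  have V: "\<bar>sq (V k)\<bar> \<le> sq (V k) + sq (D k)" and D: "\<bar>sq (D k)\<bar> \<le> sq (V k) + sq (D k)" for k
    using nonneg[of "V k"] nonneg[of "D k"] by auto
  show "summable (\<lambda>k. \<tau> k * sq (V k))" 
    by (rule dom, rule le) (use V in auto)
  show "summable (\<lambda>k. \<tau> k * ip (V k) (D k))"
    by (rule dom, rule le) (use abs_ip_le in auto)
  show kV: "summable (\<lambda>k. real k * sq (V k))" 
    by (rule dom, rule le) (use V in auto)
  show "summable (\<lambda>k. real k * sq (D k))" 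
    by (rule dom, rule le) (use D in auto)
  have "summable (\<lambda>k. 1 * sq (V k))" 
    by (rule dom, rule le) (use V in auto)
  then show "summable (\<lambda>k. sq (V k))" by simp
qed

text \<open>Each term in the exact increment of the anchor energy has just been shown to be summable.\<close>
lemma convergent_anchor_energy:
  assumes z: "J z = z"
  shows "convergent (anchor_energy z)"
proof (rule convergent_if_differences_summable)
  obtain \<eta> :: real where "summable (\<lambda>k. ip (U (Suc k) - z) (D (Suc k)))"
    using energy_consequences[OF z] by metis
  moreover note sum = summable_velocity_residual[OF z]
  have "summable (\<lambda>k. \<tau> (Suc k) * sq (V (Suc k)))"
    "summable (\<lambda>k. \<tau> (Suc k) * ip (V (Suc k)) (D (Suc k)))" "summable (\<lambda>k. sq (V (Suc k)))"
    using sum(1,2,5) by (simp_all only: summable_Suc_iff[of "\<lambda>k. sq (V k)"]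
       summable_Suc_iff[of "\<lambda>k. \<tau> k * sq (V k)"] summable_Suc_iff[of "\<lambda>k. \<tau> k * ip (V k) (D k)"])
  ultimately show "summable (\<lambda>k. anchor_energy z (Suc k) - anchor_energy z k)"
    unfolding anchor_energy_Suc distrib_left by (intro summable_add summable_mult)
qed

text \<open>
  The velocity energy converges, as the difference of two convergent sequences. It is at most of the
  order of \<open>\<tau>\<^sup>2 (\<parallel>v\<parallel>\<^sup>2 + \<parallel>d\<parallel>\<^sup>2)\<close>, so dividing by the index gives something summable, and its limit is zero.
\<close>
lemma scaled_velocity_residual_tendsto_zero:
  assumes z: "J z = z"
  shows "(\<lambda>k. (\<tau> k)\<^sup>2 * sq (V k)) \<longlonglongrightarrow> 0" "(\<lambda>k. (\<tau> k)\<^sup>2 * sq (V k + D k)) \<longlonglongrightarrow> 0"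
proof -
  obtain \<eta> where \<eta>: "0 < \<eta>" "\<eta> < 1"
    and E: "convergent (\<lambda>k. \<theta> * anchor_energy z k + velocity_energy \<eta> k)"
    and sum: "summable (\<lambda>k. \<tau> k * (sq (V k) + sq (D k)))"
    using energy_consequences[OF z] by metis
  have nonneg': "0 \<le> velocity_energy \<eta> k" for k
    using \<eta> nonneg by (simp add: velocity_energy_def)
  have "convergent (\<lambda>k. (\<theta> * anchor_energy z k + velocity_energy \<eta> k) - \<theta> * anchor_energy z k)"
    by (intro convergent_diff E convergent_mult convergent_const convergent_anchor_energy z)
  then obtain l where l: "velocity_energy \<eta> \<longlonglongrightarrow> l"
    by (auto simp: convergent_def)
  have "summable (\<lambda>k. velocity_energy \<eta> k / real k)"
  proof (rule summable_comparison_test_ev)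
    show "summable (\<lambda>k. 3 * (\<tau> k * (sq (V k) + sq (D k))))"
      using sum by (rule summable_mult)
    show "eventually (\<lambda>k. norm (velocity_energy \<eta> k / real k) \<le> 3 * (\<tau> k * (sq (V k) + sq (D k)))) sequentially"
      using eventually_index_le_\<tau> eventually_gt_at_top[of 0]
    proof eventually_elim
      fix k :: nat assume k: "0 < \<tau> k \<and> real k \<le> 2 * \<tau> k \<and> \<tau> k \<le> 2 * real k" "0 < k"
      define S where "S = sq (V k) + sq (D k)"
      have "sq (V k + D k) = S + 2 * ip (V k) (D k)"
        by (simp add: S_def expand commute[of "D k" "V k"])
      also have "\<dots> \<le> 3 * S"
        using order_trans[OF abs_ge_self abs_ip_le, of "V k" "D k"] unfolding S_def by argo
      finally have "\<eta> * sq (V k + D k) \<le> \<eta> * (3 * S)"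
        using \<eta> by (intro mult_left_mono) auto
      moreover have "sq (V k) \<le> 3 * S"
        using nonneg[of "D k"] nonneg[of "V k"] by (simp add: S_def)
      then have "(1 - \<eta>) * sq (V k) \<le> (1 - \<eta>) * (3 * S)"
        using \<eta> by (intro mult_left_mono) auto
      ultimately have "\<eta> * sq (V k + D k) + (1 - \<eta>) * sq (V k) \<le> \<eta> * (3 * S) + (1 - \<eta>) * (3 * S)"
        by (rule add_mono)
      also have "\<dots> = 3 * S" by (simp add: algebra_simps)
      finally have "velocity_energy \<eta> k \<le> (\<tau> k)\<^sup>2 / 2 * (3 * S)"
        unfolding velocity_energy_def by (intro mult_left_mono) auto
      also have "\<dots> = (3 * (\<tau> k * S)) * (\<tau> k / 2)"
        by (simp add: power2_eq_square)
      also have "\<dots> \<le> (3 * (\<tau> k * S)) * real k"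
      proof (rule mult_left_mono)
        show "\<tau> k / 2 \<le> real k" using k by simp
        show "0 \<le> 3 * (\<tau> k * S)" using k nonneg[of "D k"] nonneg[of "V k"] by (simp add: S_def)
      qed
      finally have "velocity_energy \<eta> k / real k \<le> 3 * (\<tau> k * S)"
        using k by (simp only: pos_divide_le_eq of_nat_0_less_iff)
      then show "norm (velocity_energy \<eta> k / real k) \<le> 3 * (\<tau> k * (sq (V k) + sq (D k)))"
        using nonneg'[of k] by (simp add: S_def)
    qed
  qed
  from weighted_summable_limit_eq_zero[OF l nonneg' this] l have l0: "velocity_energy \<eta> \<longlonglongrightarrow> 0"
    by simp
  have dom: "f \<longlonglongrightarrow> 0" if "c > 0" "\<And>k. 0 \<le> f k" "\<And>k. c * f k \<le> velocity_energy \<eta> k" for f c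
  proof (rule tendsto_sandwich[OF _ _ tendsto_const])
    show "(\<lambda>k. velocity_energy \<eta> k / c) \<longlonglongrightarrow> 0"
      using tendsto_divide[OF l0 tendsto_const[of c]] that(1) by simp
    show "eventually (\<lambda>k. f k \<le> velocity_energy \<eta> k / c) sequentially"
      using that by (intro always_eventually) (simp add: pos_le_divide_eq mult.commute)
  qed (use that in simp)
  have eq: "velocity_energy \<eta> k = \<eta> / 2 * ((\<tau> k)\<^sup>2 * sq (V k + D k)) + (1 - \<eta>) / 2 * ((\<tau> k)\<^sup>2 * sq (V k))" for k
    unfolding velocity_energy_def by (simp add: field_simps)
  show "(\<lambda>k. (\<tau> k)\<^sup>2 * sq (V k)) \<longlonglongrightarrow> 0"
    by (rule dom[of "(1 - \<eta>) / 2"]) (use \<eta> nonneg in \<open>auto simp: eq\<close>)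
  show "(\<lambda>k. (\<tau> k)\<^sup>2 * sq (V k + D k)) \<longlonglongrightarrow> 0"
    by (rule dom[of "\<eta> / 2"]) (use \<eta> nonneg in \<open>auto simp: eq\<close>)
qed

text \<open>
  In the convergent anchor energy the term \<open>\<tau> \<langle>u - z, v + d\<rangle>\<close> vanishes in the limit, since
  \<open>u - z\<close> is bounded and \<open>\<tau> (v + d)\<close> tends to zero.
\<close>
lemma seminorm_distance_convergent:
  assumes z: "J z = z"
  shows "convergent (\<lambda>k. sq (U k - z))"
proof -
  obtain \<eta> :: real where B: "Bseq (\<lambda>k. sq (U (Suc k) - z))"
    using energy_consequences[OF z] by metis
  have "(\<lambda>k. (\<tau> k)\<^sup>2 * sq (V k + D k) * sq (U (Suc k) - z)) \<longlonglongrightarrow> 0"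
  proof -
    obtain K where "\<And>k. norm (sq (U (Suc k) - z)) \<le> K"
      using B unfolding Bseq_def by blast
    then show ?thesis
      by (intro lim_null_mult_right_bounded[OF scaled_velocity_residual_tendsto_zero(2)[OF z]] always_eventually) blast
  qed
  then have "(\<lambda>k. (\<tau> k * ip (U (Suc k) - z) (V k + D k))\<^sup>2) \<longlonglongrightarrow> 0"
  proof (rule tendsto_sandwich[OF _ _ tendsto_const, rotated 2])
    show "eventually (\<lambda>k. (\<tau> k * ip (U (Suc k) - z) (V k + D k))\<^sup>2 \<le> (\<tau> k)\<^sup>2 * sq (V k + D k) * sq (U (Suc k) - z)) sequentially"
      using mult_left_mono[OF Cauchy_Schwarz zero_le_power2] 
      by (intro always_eventually) (simp add: power_mult_distrib mult.assoc mult.commute[of "sq (V _ + D _)"])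
  qed simp
  then have 0: "(\<lambda>k. \<tau> k * ip (U (Suc k) - z) (V k + D k)) \<longlonglongrightarrow> 0"
    by (simp add: power_tendsto_0_iff)
  obtain l where "anchor_energy z \<longlonglongrightarrow> l"
    using convergent_anchor_energy[OF z] by (auto simp: convergent_def)
  then have "(\<lambda>k. (anchor_energy z k - \<tau> k * ip (U (Suc k) - z) (V k + D k)) * (2 / (\<alpha> - 1))) \<longlonglongrightarrow> (l - 0) * (2 / (\<alpha> - 1))"
    by (intro tendsto_intros 0)
  moreover have "(anchor_energy z k - \<tau> k * ip (U (Suc k) - z) (V k + D k)) * (2 / (\<alpha> - 1)) = sq (U (Suc k) - z)" for k
    using \<alpha> by (simp add: anchor_energy_def)
  ultimately have "convergent (\<lambda>k. sq (U (Suc k) - z))"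
    by (auto simp: convergent_def)
  then show ?thesis
    by (simp add: convergent_Suc_iff[of "\<lambda>k. sq (U k - z)"])
qed

lemma velocity_displacement_rates:
  assumes z: "J z = z"
  shows "(\<lambda>k. (real k)\<^sup>2 * sq (V k)) \<longlonglongrightarrow> 0" "(\<lambda>k. (real k)\<^sup>2 * sq (D k)) \<longlonglongrightarrow> 0"
proof -
  note lim = scaled_velocity_residual_tendsto_zero[OF z]
  have dom: "(\<lambda>k. (real k)\<^sup>2 * f k) \<longlonglongrightarrow> 0" if "\<And>k. 0 \<le> f k" "(\<lambda>k. (\<tau> k)\<^sup>2 * f k) \<longlonglongrightarrow> 0" for f
  proof (rule tendsto_sandwich[OF _ _ tendsto_const])
    show "(\<lambda>k. 4 * ((\<tau> k)\<^sup>2 * f k)) \<longlonglongrightarrow> 0"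
      using tendsto_mult[OF tendsto_const that(2), of 4] by simp
    show "eventually (\<lambda>k. (real k)\<^sup>2 * f k \<le> 4 * ((\<tau> k)\<^sup>2 * f k)) sequentially"
      using eventually_index_le_\<tau>
    proof eventually_elim
      case (elim k)
      then have "(real k)\<^sup>2 \<le> (2 * \<tau> k)\<^sup>2" by (intro power_mono) auto
      from mult_right_mono[OF this that(1)] show ?case
        by (simp add: power_mult_distrib mult.assoc)
    qed
  qed (use that in simp)
  show "(\<lambda>k. (real k)\<^sup>2 * sq (V k)) \<longlonglongrightarrow> 0"
    by (rule dom) (use nonneg lim in auto)
  show "(\<lambda>k. (real k)\<^sup>2 * sq (D k)) \<longlonglongrightarrow> 0"
  proof (rule dom)
    show "(\<lambda>k. (\<tau> k)\<^sup>2 * sq (D k)) \<longlonglongrightarrow> 0"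
    proof (rule tendsto_sandwich[OF _ _ tendsto_const])
      show "(\<lambda>k. 2 * ((\<tau> k)\<^sup>2 * sq (V k + D k)) + 2 * ((\<tau> k)\<^sup>2 * sq (V k))) \<longlonglongrightarrow> 0"
        using tendsto_add[OF tendsto_mult[OF tendsto_const lim(2), of 2] tendsto_mult[OF tendsto_const lim(1), of 2]]
        by simp
      have "sq (D k) \<le> 2 * sq (V k + D k) + 2 * sq (V k)" for k
        using nonneg[of "(V k + D k) + V k"] by (simp add: expand commute[of "D k" "V k"])
      from mult_left_mono[OF this zero_le_power2, of "\<tau> _"]
      show "eventually (\<lambda>k. (\<tau> k)\<^sup>2 * sq (D k) \<le> 2 * ((\<tau> k)\<^sup>2 * sq (V k + D k)) + 2 * ((\<tau> k)\<^sup>2 * sq (V k))) sequentially"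
        unfolding distrib_left mult.left_commute[of "_\<^sup>2" 2] by (rule always_eventually[OF allI])
    qed (use nonneg in simp)
  qed (rule nonneg)
qed

abbreviation Q :: "nat \<Rightarrow> 'a" where "Q k \<equiv> U (Suc k) - J (U (Suc k))"

lemma D_Suc: "D (Suc k) = s *\<^sub>R Q k"
  by (simp add: D_def)

lemma sq_D_Suc: "sq (D (Suc k)) = s\<^sup>2 * sq (Q k)"
  unfolding D_Suc scaleR_left scaleR_right by (simp only: power2_eq_square mult.assoc)

text \<open>The gap \<open>\<langle>u - J u, J u - z\<rangle>\<close> lies below \<open>\<langle>u - J u, u - z\<rangle>\<close>, which the energy estimate controls.\<close>
lemma gap_bounds:
  assumes z: "J z = z"
  shows "0 \<le> ip (Q k) (J (U (Suc k)) - z)" "ip (Q k) (J (U (Suc k)) - z) \<le> ip (Q k) (U (Suc k) - z)"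
proof -
  show "0 \<le> ip (Q k) (J (U (Suc k)) - z)"
    using firm[of "U (Suc k)" z] z by (simp add: commute)
  have "J (U (Suc k)) - z = (U (Suc k) - z) - Q k" by simp
  then have "ip (Q k) (J (U (Suc k)) - z) = ip (Q k) (U (Suc k) - z) - sq (Q k)"
    using diff_right by metis
  with nonneg[of "Q k"] show "ip (Q k) (J (U (Suc k)) - z) \<le> ip (Q k) (U (Suc k) - z)"
    by simp
qed

theorem summability:
  assumes z: "J z = z"
  shows "summable (\<lambda>k. ip (Q k) (J (U (Suc k)) - z))"
    and "summable (\<lambda>k. real k * sq (Q k))"
    and "summable (\<lambda>k. real k * sq (V k))"
proof -
  have "summable (\<lambda>k. ip (U (Suc k) - z) (D (Suc k)))"
    by (rule energy_consequences[OF z])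
  then have "summable (\<lambda>k. s * ip (Q k) (U (Suc k) - z))"
    unfolding D_Suc scaleR_right commute[of _ "Q _"] .
  then have "summable (\<lambda>k. ip (Q k) (U (Suc k) - z))"
    using s by (subst (asm) summable_cmult_iff) auto
  then show "summable (\<lambda>k. ip (Q k) (J (U (Suc k)) - z))"
    by (rule summable_comparison_test'[of _ 0]) (use gap_bounds[OF z] in simp)
  have "summable (\<lambda>k. real (Suc k) * sq (D (Suc k)))"
    using summable_velocity_residual(4)[OF z] by (simp only: summable_Suc_iff[of "\<lambda>k. real k * sq (D k)"])
  then have "summable (\<lambda>k. s\<^sup>2 * (real (Suc k) * sq (Q k)))"
    unfolding sq_D_Suc by (simp only: mult.left_commute)
  then have "summable (\<lambda>k. real (Suc k) * sq (Q k))"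
    using s by (subst (asm) summable_cmult_iff) auto
  then show "summable (\<lambda>k. real k * sq (Q k))"
    by (rule summable_comparison_test'[of _ 0])
       (use nonneg in \<open>auto simp: abs_mult intro: mult_right_mono\<close>)
  show "summable (\<lambda>k. real k * sq (V k))"
    by (rule summable_velocity_residual(3)[OF z])
qed

theorem residual_rate:
  assumes z: "J z = z"
  shows "(\<lambda>k. (real k)\<^sup>2 * sq (Q k)) \<longlonglongrightarrow> 0"
proof (rule tendsto_sandwich[OF _ _ tendsto_const])
  have "(\<lambda>k. (real (Suc k))\<^sup>2 * sq (D (Suc k))) \<longlonglongrightarrow> 0"
    using velocity_displacement_rates(2)[OF z] by (rule LIMSEQ_Suc)
  from tendsto_divide[OF this tendsto_const[of "s\<^sup>2"]]
  show "(\<lambda>k. (real (Suc k))\<^sup>2 * sq (Q k)) \<longlonglongrightarrow> 0"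
    using s unfolding sq_D_Suc by simp
  show "eventually (\<lambda>k. (real k)\<^sup>2 * sq (Q k) \<le> (real (Suc k))\<^sup>2 * sq (Q k)) sequentially"
    by (intro always_eventually allI mult_right_mono power_mono nonneg) auto
qed (use nonneg in simp)

theorem gap_rate:
  assumes z: "J z = z"
  shows "(\<lambda>k. real k * ip (Q k) (J (U (Suc k)) - z)) \<longlonglongrightarrow> 0"
proof (rule tendsto_sandwich[OF _ _ tendsto_const])
  have "convergent (\<lambda>k. sq (U (Suc k) - z))"
    using seminorm_distance_convergent[OF z] by (simp add: convergent_Suc_iff[of "\<lambda>k. sq (U k - z)"])
  then obtain l where l: "(\<lambda>k. sq (U (Suc k) - z)) \<longlonglongrightarrow> l"
    by (auto simp: convergent_def)
  have "(\<lambda>k. (real k * ip (Q k) (U (Suc k) - z))\<^sup>2) \<longlonglongrightarrow> 0"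
  proof (rule tendsto_sandwich[OF _ _ tendsto_const])
    show "(\<lambda>k. (real k)\<^sup>2 * sq (Q k) * sq (U (Suc k) - z)) \<longlonglongrightarrow> 0"
      using tendsto_mult[OF residual_rate[OF z] l] by simp
    show "eventually (\<lambda>k. (real k * ip (Q k) (U (Suc k) - z))\<^sup>2 \<le> (real k)\<^sup>2 * sq (Q k) * sq (U (Suc k) - z)) sequentially"
      unfolding power_mult_distrib mult.assoc
      by (intro always_eventually allI mult_left_mono Cauchy_Schwarz) simp
  qed simp
  then show "(\<lambda>k. real k * ip (Q k) (U (Suc k) - z)) \<longlonglongrightarrow> 0"
    by simp
  show "eventually (\<lambda>k. real k * ip (Q k) (J (U (Suc k)) - z) \<le> real k * ip (Q k) (U (Suc k) - z)) sequentially"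
    using gap_bounds(2)[OF z] by (intro always_eventually allI mult_left_mono) auto
  show "eventually (\<lambda>k. 0 \<le> real k * ip (Q k) (J (U (Suc k)) - z)) sequentially"
    using gap_bounds(1)[OF z] by (intro always_eventually allI mult_nonneg_nonneg) auto
qed

theorem residual_tendsto_zero:
  assumes z: "J z = z"
  shows "(\<lambda>k. sq (Q k)) \<longlonglongrightarrow> 0"
proof (rule tendsto_sandwich[OF _ _ tendsto_const residual_rate[OF z]])
  show "eventually (\<lambda>k. sq (Q k) \<le> (real k)\<^sup>2 * sq (Q k)) sequentially"
    using eventually_ge_at_top[of 1]
  proof eventually_elim
    case (elim k)
    then have "1 * sq (Q k) \<le> (real k)\<^sup>2 * sq (Q k)"
      by (intro mult_right_mono nonneg one_le_power) auto
    then show ?case by simp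
  qed
qed (use nonneg in simp)

end

section \<open>Maximal monotone operators and degenerate resolvents\<close>

lemma maximal_monotone_monotoneD:
  assumes "maximal_monotone A" "a \<in> A x" "b \<in> A y"
  shows "0 \<le> (x - y) \<bullet> (a - b)"
  using assms unfolding maximal_monotone_def monotone_operator_def op_graph_def by blast

text \<open>Otherwise the pair could be added to the graph.\<close>
lemma maximal_monotone_memI:
  assumes max: "maximal_monotone A"
    and rel: "\<And>v b. b \<in> A v \<Longrightarrow> 0 \<le> (p - v) \<bullet> (q - b)"
  shows "q \<in> A p"
proof -
  define A' where "A' = A(p := insert q (A p))"
  have graph: "op_graph A' = insert (p, q) (op_graph A)"
    by (auto simp: op_graph_def A'_def split: if_splits)
  have "0 \<le> (v - p) \<bullet> (b - q)" if "b \<in> A v" for v b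
    using rel[OF that] by (simp add: inner_diff_left inner_diff_right algebra_simps)
  then have "monotone_operator A'"
    using max rel unfolding monotone_operator_def maximal_monotone_def graph
    by (auto simp: op_graph_def)
  then have "op_graph A' = op_graph A"
    using max graph unfolding maximal_monotone_def by blast
  then show ?thesis
    using graph by (auto simp: op_graph_def)
qed

text \<open>
  Monotonicity against a fixed pair of the graph passes to the limit, because the inner product of a
  bounded weakly convergent family with a strongly convergent one converges; maximality then puts
  the limit into the graph.
\<close>
lemma maximal_monotone_weak_strong_closed:
  assumes max: "maximal_monotone A" and G: "G \<noteq> bot"
    and a: "\<And>i. a i \<in> A (x i)" and bound: "\<And>i. norm (x i) \<le> R"
    and x: "\<And>y. ((\<lambda>i. x i \<bullet> y) \<longlongrightarrow> p \<bullet> y) G" and lim: "(a \<longlongrightarrow> q) G"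
  shows "q \<in> A p"
proof (rule maximal_monotone_memI[OF max])
  fix v b assume b: "b \<in> A v"
  have "((\<lambda>i. x i \<bullet> (a i - q)) \<longlongrightarrow> 0) G"
  proof (rule Lim_null_comparison)
    show "((\<lambda>i. R * norm (a i - q)) \<longlongrightarrow> 0) G"
      using tendsto_mult[OF tendsto_const tendsto_norm_zero[OF LIM_zero[OF lim]], of R] by simp
    show "eventually (\<lambda>i. norm (x i \<bullet> (a i - q)) \<le> R * norm (a i - q)) G"
      using order_trans[OF Cauchy_Schwarz_ineq2 mult_right_mono[OF bound norm_ge_zero]]
      by (intro always_eventually) simp
  qed
  then have "((\<lambda>i. x i \<bullet> (a i - q) + x i \<bullet> (q - b) - v \<bullet> (a i - b)) \<longlongrightarrow> 0 + p \<bullet> (q - b) - v \<bullet> (q - b)) G"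
    by (intro tendsto_intros x lim)
  then have "((\<lambda>i. (x i - v) \<bullet> (a i - b)) \<longlongrightarrow> (p - v) \<bullet> (q - b)) G"
    by (simp add: inner_diff_left inner_diff_right algebra_simps)
  then show "0 \<le> (p - v) \<bullet> (q - b)"
    by (rule tendsto_lowerbound)
       (use G maximal_monotone_monotoneD[OF max a b] in \<open>auto intro: always_eventually\<close>)
qed

lemma mem_resolvent_iff: "y \<in> resolvent B x \<longleftrightarrow> x - y \<in> B y"
  unfolding resolvent_def op_inverse_def op_plus_def
  by (auto simp: image_iff algebra_simps intro: bexI[of _ "x - y"])

locale degenerate_preconditioner =
  fixes A :: "'h::{real_inner, complete_space} \<Rightarrow> 'h set" and M :: "'h \<Rightarrow> 'h"
  assumes maximal: "maximal_monotone A"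
    and bounded_linear_M: "bounded_linear M"
    and self_adjoint: "M x \<bullet> y = x \<bullet> M y"
    and psd: "0 \<le> x \<bullet> M x"
    and lipschitz: "op_lipschitz_over (range M) (op_inverse (op_plus M A))"
    and full_domain: "resolvent (inv_comp M A) x \<noteq> {}"
begin

sublocale M: bounded_linear M by (rule bounded_linear_M)

sublocale semi_inner_product "M_inner M"
proof
  show "M_inner M x y = M_inner M y x" for x y
    unfolding M_inner_def by (metis self_adjoint inner_commute)
qed (simp_all add: M_inner_def inner_add_left psd)

definition J :: "'h \<Rightarrow> 'h" where "J = resolvent_map (inv_comp M A)"

lemma mem_resolvent_M_iff: "y \<in> resolvent (inv_comp M A) x \<longleftrightarrow> M (x - y) \<in> A y"
  by (simp add: mem_resolvent_iff inv_comp_def)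

text \<open>
  \<open>M (x - y) \<in> A y\<close> says that \<open>y\<close> is a value of \<open>(M + A)\<^sup>-\<^sup>1 M\<close> at \<open>x\<close>; this form serves before
  single-valuedness of the resolvent is known.
\<close>
lemma J_lipschitz_wrt_M:
  obtains L where "0 \<le> L"
    "\<And>x x' y y'. M (x - y) \<in> A y \<Longrightarrow> M (x' - y') \<in> A y' \<Longrightarrow> norm (y - y') \<le> L * norm (M (x - x'))"
proof -
  obtain L where L: "0 \<le> L" "\<And>p p' v v'. p \<in> range M \<Longrightarrow> p' \<in> range M \<Longrightarrow>
     v \<in> op_inverse (op_plus M A) p \<Longrightarrow> v' \<in> op_inverse (op_plus M A) p' \<Longrightarrow> norm (v - v') \<le> L * norm (p - p')"
    using lipschitz unfolding op_lipschitz_over_def by metis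
  have "y \<in> op_inverse (op_plus M A) (M x)" if "M (x - y) \<in> A y" for x y
    using that unfolding resolvent_inv_comp[OF bounded_linear_M, symmetric] mem_resolvent_M_iff .
  with L show ?thesis
    by (intro that[of L]) (auto simp: M.diff)
qed

lemma J_eq_iff: "J x = y \<longleftrightarrow> M (x - y) \<in> A y"
proof -
  obtain y0 where y0: "M (x - y0) \<in> A y0"
    using full_domain[of x] mem_resolvent_M_iff by blast
  obtain L where "0 \<le> L"
    and L: "\<And>x x' y y'. M (x - y) \<in> A y \<Longrightarrow> M (x' - y') \<in> A y' \<Longrightarrow> norm (y - y') \<le> L * norm (M (x - x'))"
    by (rule J_lipschitz_wrt_M) blast
  have unique: "y = y0" if "M (x - y) \<in> A y" for y
    using L[OF that y0] by (simp add: M.zero)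
  then have "resolvent (inv_comp M A) x = {y0}"
    using y0 unique unfolding set_eq_iff mem_resolvent_M_iff by blast
  then have "J x = y0" by (simp add: J_def resolvent_map_def)
  with y0 unique show ?thesis by metis
qed

lemma M_residual_in_A: "M (x - J x) \<in> A (J x)"
  using J_eq_iff by blast

lemma zer_iff_fixpoint: "z \<in> zer A \<longleftrightarrow> J z = z"
  by (simp add: J_eq_iff zer_def M.zero)

lemma J_firmly_nonexpansive: "0 \<le> M_inner M (J x - J y) ((x - J x) - (y - J y))"
  using maximal_monotone_monotoneD[OF maximal M_residual_in_A[of x] M_residual_in_A[of y]]
  by (simp add: M_inner_def M.diff)

text \<open>
  Cauchy-Schwarz for the semi-inner product gives \<open>\<parallel>M x\<parallel>\<^sup>2 = \<langle>x, M x\<rangle>\<^sub>M \<le> \<parallel>x\<parallel>\<^sub>M \<parallel>M x\<parallel>\<^sub>M\<close>, and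
  \<open>\<parallel>M x\<parallel>\<^sub>M\<close> is bounded by a multiple of \<open>\<parallel>M x\<parallel>\<close>. This avoids the square root of \<open>M\<close>.
\<close>
lemma norm_M_le_seminorm:
  obtains K where "0 \<le> K" "\<And>x. (norm (M x))\<^sup>2 \<le> K * sq x"
proof -
  obtain K where K: "0 \<le> K" "\<And>x. norm (M x) \<le> norm x * K"
    using M.nonneg_bounded by blast
  have "(norm (M x))\<^sup>2 \<le> K * sq x" for x
  proof (cases "M x = 0")
    case False
    have "M_inner M (M x) (M x) \<le> norm (M x) * norm (M (M x))"
      unfolding M_inner_def by (rule norm_cauchy_schwarz)
    also have "\<dots> \<le> norm (M x) * (norm (M x) * K)"
      by (intro mult_left_mono K) simp
    finally have 1: "sq (M x) \<le> (norm (M x))\<^sup>2 * K"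
      by (simp add: power2_eq_square mult.assoc)
    have "M_inner M x (M x) = (norm (M x))\<^sup>2"
      by (simp add: M_inner_def power2_norm_eq_inner self_adjoint[symmetric])
    then have "((norm (M x))\<^sup>2)\<^sup>2 \<le> sq x * sq (M x)"
      using Cauchy_Schwarz[of x "M x"] by simp
    also have "\<dots> \<le> sq x * ((norm (M x))\<^sup>2 * K)"
      by (intro mult_left_mono 1 nonneg)
    finally have "(norm (M x))\<^sup>2 * (norm (M x))\<^sup>2 \<le> (norm (M x))\<^sup>2 * (K * sq x)"
      by (simp only: power2_eq_square[of "(norm (M x))\<^sup>2"] mult_ac)
    then show ?thesis
      by (rule mult_left_le_imp_le) (use False in simp)
  qed (use K nonneg in simp)
  with K show ?thesis by (intro that[of K])
qed

lemma J_lipschitz_wrt_seminorm: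
  obtains L where "0 \<le> L" "\<And>x y. (norm (J x - J y))\<^sup>2 \<le> L * sq (x - y)"
proof -
  obtain L where L: "0 \<le> L"
    "\<And>x x' y y'. M (x - y) \<in> A y \<Longrightarrow> M (x' - y') \<in> A y' \<Longrightarrow> norm (y - y') \<le> L * norm (M (x - x'))"
    using J_lipschitz_wrt_M by blast
  obtain K where K: "0 \<le> K" "\<And>x. (norm (M x))\<^sup>2 \<le> K * sq x"
    using norm_M_le_seminorm by blast
  have "(norm (J x - J y))\<^sup>2 \<le> (L\<^sup>2 * K) * sq (x - y)" for x y
  proof -
    have "(norm (J x - J y))\<^sup>2 \<le> (L * norm (M (x - y)))\<^sup>2"
      using L(2)[OF M_residual_in_A M_residual_in_A] by (intro power_mono) auto
    also have "\<dots> \<le> L\<^sup>2 * (K * sq (x - y))"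
      unfolding power_mult_distrib by (intro mult_left_mono K) simp
    finally show ?thesis by (simp add: mult.assoc)
  qed
  with L K show ?thesis by (intro that[of "L\<^sup>2 * K"]) auto
qed

lemma tendsto_M_inner_zero:
  assumes "((\<lambda>i. sq (x i)) \<longlongrightarrow> 0) F"
  shows "((\<lambda>i. M_inner M (x i) y) \<longlongrightarrow> 0) F"
proof -
  have "((\<lambda>i. (M_inner M (x i) y)\<^sup>2) \<longlongrightarrow> 0) F"
  proof (rule tendsto_sandwich[OF _ _ tendsto_const])
    show "((\<lambda>i. sq (x i) * sq y) \<longlongrightarrow> 0) F"
      using tendsto_mult[OF assms tendsto_const, of "sq y"] by simp
    show "eventually (\<lambda>i. (M_inner M (x i) y)\<^sup>2 \<le> sq (x i) * sq y) F"
      by (intro always_eventually allI Cauchy_Schwarz)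
  qed simp
  then show ?thesis by simp
qed

text \<open>
  The seminorm alone cannot separate two weak cluster points \<open>p\<close>, \<open>q\<close> of the shadow sequence. But
  the usual Opial computation gives \<open>\<parallel>p - q\<parallel>\<^sub>M = 0\<close>, so \<open>J p = J q\<close>, and both are fixed points of \<open>J\<close>.
\<close>
theorem degenerate_Opial:
  fixes x :: "nat \<Rightarrow> 'h"
  assumes "zer A \<noteq> {}"
    and dist: "\<And>z. z \<in> zer A \<Longrightarrow> convergent (\<lambda>k. sq (x k - z))"
    and res: "(\<lambda>k. sq (x k - J (x k))) \<longlonglongrightarrow> 0"
  obtains z where "z \<in> zer A" "weakly_converges (\<lambda>k. J (x k)) z"
proof -
  obtain L where L: "0 \<le> L" "\<And>x y. (norm (J x - J y))\<^sup>2 \<le> L * sq (x - y)"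
    using J_lipschitz_wrt_seminorm by blast
  obtain K where K: "0 \<le> K" "\<And>x. (norm (M x))\<^sup>2 \<le> K * sq x"
    using norm_M_le_seminorm by blast
  obtain z0 where z0: "z0 \<in> zer A" using assms(1) by blast
  obtain B where B: "\<And>k. norm (sq (x k - z0)) \<le> B"
    using convergent_imp_Bseq[OF dist[OF z0]] unfolding Bseq_def by blast
  have bound: "norm (J (x k)) \<le> sqrt (L * B) + norm z0" for k
  proof -
    have "(norm (J (x k) - z0))\<^sup>2 \<le> L * sq (x k - z0)"
      using L(2)[of "x k" z0] z0 by (simp add: zer_iff_fixpoint)
    also have "\<dots> \<le> L * B"
      using B[of k] L(1) by (intro mult_left_mono) auto
    finally have "norm (J (x k) - z0) \<le> sqrt (L * B)"
      by (rule real_le_rsqrt)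
    then show ?thesis
      using norm_triangle_ineq[of "J (x k) - z0" z0] by simp
  qed
  have "(\<lambda>k. (norm (M (x k - J (x k))))\<^sup>2) \<longlonglongrightarrow> 0"
  proof (rule tendsto_sandwich[OF _ _ tendsto_const])
    show "(\<lambda>k. K * sq (x k - J (x k))) \<longlonglongrightarrow> 0"
      using tendsto_mult[OF tendsto_const res, of K] by simp
  qed (auto intro: always_eventually K)
  then have strong: "(\<lambda>k. M (x k - J (x k))) \<longlonglongrightarrow> 0"
    by (simp add: tendsto_norm_zero_iff)
  have cluster: "p \<in> zer A"
    if "G \<le> sequentially" "G \<noteq> bot" "\<And>y. ((\<lambda>k. J (x k) \<bullet> y) \<longlongrightarrow> p \<bullet> y) G" for G p
  proof -
    have "0 \<in> A p"
      by (rule maximal_monotone_weak_strong_closed[OF maximal that(2) M_residual_in_A bound that(3)])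
         (rule tendsto_mono[OF that(1) strong])
    then show ?thesis by (simp add: zer_def)
  qed
  obtain G p where G: "G \<le> sequentially" "G \<noteq> bot" "\<And>y. ((\<lambda>k. J (x k) \<bullet> y) \<longlongrightarrow> p \<bullet> y) G"
    using bounded_imp_weak_cluster_point[of sequentially "\<lambda>k. J (x k)", OF _ bound]
      sequentially_bot by blast
  have p: "p \<in> zer A" using cluster[OF G] .
  have "weakly_converges (\<lambda>k. J (x k)) p"
  proof (rule weakly_converges_if_unique_cluster_point[OF bound])
    fix G' q assume G': "G' \<le> sequentially" "G' \<noteq> bot" "\<And>y. ((\<lambda>k. J (x k) \<bullet> y) \<longlongrightarrow> q \<bullet> y) G'"
    have q: "q \<in> zer A" using cluster[OF G'] .
    obtain lp lq where "(\<lambda>k. sq (x k - p)) \<longlonglongrightarrow> lp" "(\<lambda>k. sq (x k - q)) \<longlonglongrightarrow> lq"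
      using dist[OF p] dist[OF q] by (auto simp: convergent_def)
    then have "(\<lambda>k. (sq p - sq q - (sq (x k - p) - sq (x k - q))) / 2) \<longlonglongrightarrow> (sq p - sq q - (lp - lq)) / 2"
      by (intro tendsto_intros) auto
    \<comment> \<open>Polarisation turns convergence of both distances into convergence of a product with \<open>p - q\<close>,
        and the vanishing residual allows replacing \<open>x k\<close> by its image under \<open>J\<close>.\<close>
    moreover have "(sq p - sq q - (sq (x k - p) - sq (x k - q))) / 2 = M_inner M (x k) (p - q)" for k
      by (simp add: expand commute[of p "x k"] commute[of q "x k"])
    ultimately obtain l where l: "(\<lambda>k. M_inner M (x k) (p - q)) \<longlonglongrightarrow> l"
      by auto
    have "(\<lambda>k. M_inner M (x k) (p - q) - M_inner M (x k - J (x k)) (p - q)) \<longlonglongrightarrow> l - 0"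
      by (intro tendsto_diff l tendsto_M_inner_zero res)
    then have "(\<lambda>k. J (x k) \<bullet> M (p - q)) \<longlonglongrightarrow> l"
      by (simp add: M_inner_def inner_diff_left)
    then have "p \<bullet> M (p - q) = l" "q \<bullet> M (p - q) = l"
      using tendsto_unique[OF G(2) G(3)] tendsto_unique[OF G'(2) G'(3)] tendsto_mono G(1) G'(1) by blast+
    then have "sq (p - q) = 0"
      by (simp add: M_inner_def inner_diff_left)
    then have "M (p - q) = 0"
      using K(2)[of "p - q"] by simp
    then have "(norm (J q - J p))\<^sup>2 \<le> L * 0"
      using L(2)[of p q] \<open>sq (p - q) = 0\<close> by (simp add: norm_minus_commute)
    then show "q = p"
      using p q by (simp add: zer_iff_fixpoint)
  qed
  with p show ?thesis by (rule that)
qed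

end

section \<open>The fast iteration of a degenerate resolvent\<close>

locale degenerate_fast_KM = degenerate_preconditioner A M
  for A :: "'h::{real_inner, complete_space} \<Rightarrow> 'h set" and M +
  fixes s \<alpha> \<theta> \<sigma> :: real and u :: "int \<Rightarrow> 'h"
  assumes s: "0 < s" "s \<le> 2"
    and \<alpha>: "\<alpha> > 2"
    and \<theta>: "1 < \<theta>" "\<theta> < \<alpha> - 1"
    and \<sigma>: "\<sigma> > 0"
    and zer_nonempty: "zer A \<noteq> {}"
    and iteration: "u (int k + 1) = u (int k)
         - (\<theta> / (real k + \<sigma>)) *\<^sub>R s *\<^sub>R (u (int k) - J (u (int k)))
         + (1 - \<alpha> / (real k + \<sigma>)) *\<^sub>R
             ((u (int k) - s *\<^sub>R (u (int k) - J (u (int k))))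
               - (u (int k - 1) - s *\<^sub>R (u (int k - 1) - J (u (int k - 1)))))"
begin

sublocale KM: fast_Krasnoselskii_Mann "M_inner M" J s \<alpha> \<theta> \<sigma> "\<lambda>n. u (int n - 1)"
proof
  fix k
  have "int (Suc (Suc k)) - 1 = int k + 1" "int (Suc k) - 1 = int k" by simp_all
  then show "u (int (Suc (Suc k)) - 1) = u (int (Suc k) - 1)
         - (\<theta> / (real k + \<sigma>)) *\<^sub>R s *\<^sub>R (u (int (Suc k) - 1) - J (u (int (Suc k) - 1)))
         + (1 - \<alpha> / (real k + \<sigma>)) *\<^sub>R
             ((u (int (Suc k) - 1) - s *\<^sub>R (u (int (Suc k) - 1) - J (u (int (Suc k) - 1))))
              - (u (int k - 1) - s *\<^sub>R (u (int k - 1) - J (u (int k - 1)))))"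
    by (simp only: iteration)
qed (use J_firmly_nonexpansive s \<alpha> \<theta> \<sigma> in auto)

lemma index_Suc: "int (Suc k) - 1 = int k"
  by simp

lemma V_eq: "KM.V k = u (int k) - u (int k - 1)"
  by (simp add: KM.V_def)

lemmas summability = KM.summability[unfolded index_Suc V_eq]
  and residual_rate = KM.residual_rate[unfolded index_Suc]
  and residual_tendsto_zero = KM.residual_tendsto_zero[unfolded index_Suc]
  and gap_rate = KM.gap_rate[unfolded index_Suc]

lemma M_seminorm_square: "(M_seminorm M x)\<^sup>2 = sq x"
  by (simp add: M_seminorm_def nonneg)

lemma fixpoint_exists: "\<exists>z. J z = z"
  using zer_nonempty zer_iff_fixpoint by blast

theorem seminorm_sums:
  assumes "z \<in> zer A"
  shows "summable (\<lambda>k::nat. M_inner M (u (int k) - J (u (int k))) (J (u (int k)) - z))"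
    "summable (\<lambda>k::nat. real k * (M_seminorm M (u (int k) - J (u (int k))))\<^sup>2)"
    "summable (\<lambda>k::nat. real k * (M_seminorm M (u (int k) - u (int k - 1)))\<^sup>2)"
  using summability assms unfolding zer_iff_fixpoint M_seminorm_square by auto

theorem seminorm_little_o:
  assumes "z \<in> zer A"
  shows "(\<lambda>k::nat. M_inner M (u (int k) - J (u (int k))) (J (u (int k)) - z)) \<in> o(\<lambda>k. 1 / real k)"
    "(\<lambda>k::nat. M_seminorm M (u (int k) - u (int k - 1))) \<in> o(\<lambda>k. 1 / real k)"
    "(\<lambda>k::nat. M_seminorm M (u (int k) - J (u (int k)))) \<in> o(\<lambda>k. 1 / real k)"
  unfolding M_seminorm_def
  using assms unfolding zer_iff_fixpoint
  by (intro smallo_inverse_index smallo_inverse_index_sqrt gap_rate residual_rate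
        KM.velocity_displacement_rates(1)[unfolded V_eq]; assumption)+

theorem weak_convergence:
  obtains z where "z \<in> zer A" "weakly_converges (\<lambda>k. J (u (int k))) z"
proof (rule degenerate_Opial[OF zer_nonempty])
  fix z assume "z \<in> zer A"
  then have "convergent (\<lambda>k. sq (u (int k - 1) - z))"
    using KM.seminorm_distance_convergent by (simp add: zer_iff_fixpoint)
  then have "convergent (\<lambda>k. sq (u (int (Suc k) - 1) - z))"
    by (simp only: convergent_Suc_iff[of "\<lambda>k. sq (u (int k - 1) - z)"])
  then show "convergent (\<lambda>k. sq (u (int k) - z))"
    by (simp only: index_Suc)
next
  show "(\<lambda>k. sq (u (int k) - J (u (int k)))) \<longlonglongrightarrow> 0"
    using fixpoint_exists residual_tendsto_zero by blast
qed

text \<open>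
  For \<open>s = 1\<close> the recursion reads \<open>u\<^sup>k\<^sup>+\<^sup>1 = u\<^sup>k + \<theta>/(k + \<sigma>) (J u\<^sup>k + r\<^sub>k/\<theta> - u\<^sup>k)\<close> with
  \<open>r\<^sub>k = \<tau>\<^sub>k (J u\<^sup>k - J u\<^sup>k\<^sup>-\<^sup>1)\<close>, which tends to zero in norm by the rate for the velocity in the
  seminorm.
\<close>
theorem weak_convergence_of_iterates:
  assumes "s = 1" and lim: "weakly_converges (\<lambda>k. J (u (int k))) z"
  shows "weakly_converges (\<lambda>k. u (int k)) z"
  unfolding weakly_converges_def
proof
  fix y
  obtain L where L: "0 \<le> L" "\<And>x y. (norm (J x - J y))\<^sup>2 \<le> L * sq (x - y)"
    using J_lipschitz_wrt_seminorm by blast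
  define r where "r k = KM.\<tau> k *\<^sub>R (J (u (int k)) - J (u (int k - 1)))" for k
  have "(\<lambda>k. (norm (r k))\<^sup>2) \<longlonglongrightarrow> 0"
  proof (rule tendsto_sandwich[OF _ _ tendsto_const])
    have "(\<lambda>k. (KM.\<tau> k)\<^sup>2 * sq (KM.V k)) \<longlonglongrightarrow> 0"
      using fixpoint_exists KM.scaled_velocity_residual_tendsto_zero(1) by blast
    from tendsto_mult[OF tendsto_const this, of L]
    show "(\<lambda>k. L * ((KM.\<tau> k)\<^sup>2 * sq (KM.V k))) \<longlonglongrightarrow> 0" by simp
    show "eventually (\<lambda>k. (norm (r k))\<^sup>2 \<le> L * ((KM.\<tau> k)\<^sup>2 * sq (KM.V k))) sequentially"
      using mult_left_mono[OF L(2) zero_le_power2]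
      unfolding V_eq r_def by (intro always_eventually allI) (simp add: power_mult_distrib mult_ac)
  qed simp
  then have r: "r \<longlonglongrightarrow> 0" by (simp add: tendsto_norm_zero_iff)
  define b where "b k = J (u (int k)) \<bullet> y + (r k \<bullet> y) / \<theta>" for k
  have "(\<lambda>k. J (u (int k)) \<bullet> y) \<longlonglongrightarrow> z \<bullet> y"
    using lim by (simp add: weakly_converges_def)
  moreover have "(\<lambda>k. r k \<bullet> y / \<theta>) \<longlonglongrightarrow> 0 \<bullet> y / \<theta>"
    using \<theta> by (intro tendsto_intros r) auto
  ultimately have "b \<longlonglongrightarrow> z \<bullet> y + (0 \<bullet> y) / \<theta>"
    unfolding b_def by (rule tendsto_add)
  then have b: "b \<longlonglongrightarrow> z \<bullet> y" by simp
  show "(\<lambda>k. u (int k) \<bullet> y) \<longlonglongrightarrow> z \<bullet> y"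
  proof (rule averaging_recursion_tendsto[OF _ \<sigma> _ b])
    fix k
    define t where "t = real k + \<sigma>"
    have t: "t > 0" "KM.\<tau> k = t - \<alpha>" using \<sigma> by (auto simp: t_def KM.\<tau>_def)
    have "u (int (Suc k)) = u (int k) + (\<theta> / t) *\<^sub>R (J (u (int k)) - u (int k))
        + (1 - \<alpha> / t) *\<^sub>R (J (u (int k)) - J (u (int k - 1)))"
      using iteration[of k] \<open>s = 1\<close> by (simp add: t_def algebra_simps)
    then have "u (int (Suc k)) \<bullet> y = u (int k) \<bullet> y + (\<theta> / t) * (J (u (int k)) \<bullet> y - u (int k) \<bullet> y)
        + (1 - \<alpha> / t) * ((J (u (int k)) - J (u (int k - 1))) \<bullet> y)"
      by (simp only: inner_add_left inner_scaleR_left inner_diff_left)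
    also have "(1 - \<alpha> / t) * ((J (u (int k)) - J (u (int k - 1))) \<bullet> y) = (\<theta> / t) * ((r k \<bullet> y) / \<theta>)"
    proof -
      have "r k \<bullet> y = (t - \<alpha>) * ((J (u (int k)) - J (u (int k - 1))) \<bullet> y)"
        by (simp only: r_def inner_scaleR_left t(2))
      moreover have "(1 - \<alpha> / t) * g = (\<theta> / t) * (((t - \<alpha>) * g) / \<theta>)" for g
        using t(1) \<theta> by (simp add: field_simps)
      ultimately show ?thesis by (simp only:)
    qed
    finally show "u (int (Suc k)) \<bullet> y = u (int k) \<bullet> y + \<theta> / (real k + \<sigma>) * (b k - u (int k) \<bullet> y)"
      by (simp add: b_def t_def algebra_simps)
  qed (use \<theta> in simp)
qed

end

section \<open>Reduction along an onto decomposition\<close>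

text \<open>
  The map \<open>C\<^sup>*\<close> transports the seminorm geometry of \<open>M\<close> to the norm geometry of \<open>D\<close>.
\<close>
locale adjoint_factorisation = degenerate_preconditioner A M
  for A :: "'h::{real_inner, complete_space} \<Rightarrow> 'h set" and M +
  fixes C :: "'d::{real_inner, complete_space} \<Rightarrow> 'h"
  assumes decomposition: "onto_decomposition M C"
begin

lemma C_bounded_linear: "bounded_linear C" and M_eq: "M x = C (adjoint C x)"
  using decomposition by (simp_all add: onto_decomposition_def)

sublocale C: bounded_linear C by (rule C_bounded_linear)

lemma adjoint_inner: "adjoint C x \<bullet> d = x \<bullet> C d"
  using adjoint_works_bounded[OF C_bounded_linear, of d x] by (simp add: inner_commute)

lemma adjoint_diff: "adjoint C (x - y) = adjoint C x - adjoint C y"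
  by (rule vector_eq_ldot[THEN iffD1])
     (simp add: inner_diff_right inner_diff_left adjoint_inner inner_commute[of _ "adjoint C _"])

lemma M_inner_eq_adjoint: "M_inner M x y = adjoint C x \<bullet> adjoint C y"
  by (simp add: M_inner_def M_eq adjoint_inner)

lemma M_seminorm_eq_adjoint: "M_seminorm M x = norm (adjoint C x)"
  by (simp add: M_seminorm_def M_inner_eq_adjoint norm_eq_sqrt_inner)

lemma zer_postcomp: "zer (adjoint_postcomp C A) = adjoint C ` zer A"
  by (auto simp: zer_def adjoint_postcomp_def op_inverse_def C.zero)

text \<open>
  A point \<open>w\<close> of the resolvent at \<open>C\<^sup>* x\<close> has the form \<open>C\<^sup>* v\<close> with \<open>C (C\<^sup>* x - C\<^sup>* v) = M (x - v) \<in> A v\<close>,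
  and the only such \<open>v\<close> is \<open>J x\<close>.
\<close>
lemma resolvent_postcomp: "resolvent_map (adjoint_postcomp C A) (adjoint C x) = adjoint C (J x)"
proof -
  have "resolvent (adjoint_postcomp C A) (adjoint C x) = {adjoint C (J x)}"
  proof (rule set_eqI)
    fix w
    have "w \<in> resolvent (adjoint_postcomp C A) (adjoint C x)
        \<longleftrightarrow> (\<exists>v. w = adjoint C v \<and> C (adjoint C x - w) \<in> A v)"
      unfolding mem_resolvent_iff by (auto simp: adjoint_postcomp_def op_inverse_def)
    also have "\<dots> \<longleftrightarrow> (\<exists>v. w = adjoint C v \<and> M (x - v) \<in> A v)"
      by (auto simp: M_eq adjoint_diff)
    also have "\<dots> \<longleftrightarrow> w = adjoint C (J x)"
      unfolding J_eq_iff[symmetric] by blast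
    finally show "w \<in> resolvent (adjoint_postcomp C A) (adjoint C x) \<longleftrightarrow> w \<in> {adjoint C (J x)}"
      by simp
  qed
  then show ?thesis by (simp add: resolvent_map_def)
qed

lemma weakly_converges_adjoint:
  "weakly_converges x l \<Longrightarrow> weakly_converges (\<lambda>k. adjoint C (x k)) (adjoint C l)"
  by (simp add: weakly_converges_def adjoint_inner)

end

section \<open>The convergence theorem\<close>

theorem theorem4p5:
  fixes A :: "'h::{real_inner, complete_space} \<Rightarrow> 'h set"
    and M J T :: "'h \<Rightarrow> 'h"
    and s \<alpha> \<theta> \<sigma> :: real
    and u :: "int \<Rightarrow> 'h"
  assumes "maximal_monotone A"
    and "zer A \<noteq> {}"
    and "bounded_linear M"
    and "\<forall>x y. M x \<bullet> y = x \<bullet> M y"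
    and "\<forall>x. x \<bullet> M x \<ge> 0"
    and "op_lipschitz_over (range M) (op_inverse (op_plus M A))"
    and "\<forall>x. resolvent (inv_comp M A) x \<noteq> {}"
    and J: "J = resolvent_map (inv_comp M A)"
    and "0 < s" "s \<le> 2"
    and "\<alpha> > 2"
    and "1 < \<theta>" "\<theta> < \<alpha> - 1"
    and "\<sigma> > 0"
    and T: "T = (\<lambda>x. (1 - s) *\<^sub>R x + s *\<^sub>R J x)"
    and "\<forall>k::nat. u (int k + 1) =
           u (int k) + (\<theta> / (real k + \<sigma>)) *\<^sub>R (T (u (int k)) - u (int k))
           + (1 - \<alpha> / (real k + \<sigma>)) *\<^sub>R (T (u (int k)) - T (u (int k - 1)))"
  shows
    "(\<forall>ubar \<in> zer A.
        summable (\<lambda>k::nat. M_inner M (u (int k) - J (u (int k))) (J (u (int k)) - ubar)) \<and>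
        summable (\<lambda>k::nat. real k * (M_seminorm M (u (int k) - J (u (int k))))\<^sup>2) \<and>
        summable (\<lambda>k::nat. real k * (M_seminorm M (u (int k) - u (int k - 1)))\<^sup>2)) \<and>
     (\<forall>ubar \<in> zer A.
        (\<lambda>k::nat. M_inner M (u (int k) - J (u (int k))) (J (u (int k)) - ubar))
          \<in> o(\<lambda>k. 1 / real k) \<and>
        (\<lambda>k::nat. M_seminorm M (u (int k) - u (int k - 1))) \<in> o(\<lambda>k. 1 / real k) \<and>
        (\<lambda>k::nat. M_seminorm M (u (int k) - J (u (int k)))) \<in> o(\<lambda>k. 1 / real k)) \<and>
     (\<exists>ustar \<in> zer A.
        weakly_converges (\<lambda>k. J (u (int k))) ustar \<and>
        (s = 1 \<longrightarrow> weakly_converges (\<lambda>k. u (int k)) ustar) \<and>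
        (\<forall>C :: 'd::{real_inner, complete_space} \<Rightarrow> 'h.
          closed (range M) \<and> onto_decomposition M C \<longrightarrow>
          (let w = (\<lambda>i::int. adjoint C (u i));
               B = adjoint_postcomp C A;
               JB = resolvent_map B
           in
             (\<forall>wbar \<in> zer B.
                summable (\<lambda>k::nat. (w (int k) - JB (w (int k))) \<bullet> (JB (w (int k)) - wbar)) \<and>
                summable (\<lambda>k::nat. real k * (norm (w (int k) - JB (w (int k))))\<^sup>2) \<and>
                summable (\<lambda>k::nat. real k * (norm (w (int k) - w (int k - 1)))\<^sup>2)) \<and>
             (\<exists>wstar \<in> zer B.
                weakly_converges (\<lambda>k. JB (w (int k))) wstar \<and>
                (s = 1 \<longrightarrow> weakly_converges (\<lambda>k. w (int k)) wstar)) \<and>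
             (\<forall>wbar \<in> zer B.
                (\<lambda>k::nat. (w (int k) - JB (w (int k))) \<bullet> (JB (w (int k)) - wbar))
                  \<in> o(\<lambda>k. 1 / real k) \<and>
                (\<lambda>k::nat. norm (w (int k) - w (int k - 1))) \<in> o(\<lambda>k. 1 / real k) \<and>
                (\<lambda>k::nat. norm (w (int k) - JB (w (int k)))) \<in> o(\<lambda>k. 1 / real k)) \<and>
             weakly_converges (\<lambda>k. w (int k)) (adjoint C ustar))))"
proof -
  interpret P: degenerate_preconditioner A M
    by (rule degenerate_preconditioner.intro) (use assms in auto)
  have JP: "J = P.J" unfolding J P.J_def ..
  have T_eq: "T x = x - s *\<^sub>R (x - J x)" for x
    by (simp add: T algebra_simps)
  interpret F: degenerate_fast_KM A M s \<alpha> \<theta> \<sigma> u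
  proof
    fix k :: nat
    have "T (u (int k)) - u (int k) = - (s *\<^sub>R (u (int k) - J (u (int k))))"
      by (simp add: T_eq)
    then show "u (int k + 1) = u (int k)
         - (\<theta> / (real k + \<sigma>)) *\<^sub>R s *\<^sub>R (u (int k) - P.J (u (int k)))
         + (1 - \<alpha> / (real k + \<sigma>)) *\<^sub>R
             ((u (int k) - s *\<^sub>R (u (int k) - P.J (u (int k))))
               - (u (int k - 1) - s *\<^sub>R (u (int k - 1) - P.J (u (int k - 1)))))"
      using assms(16) unfolding JP[symmetric] T_eq[symmetric] by simp
  qed (use assms in auto)
  obtain z where z: "z \<in> zer A" "weakly_converges (\<lambda>k. J (u (int k))) z"
    using F.weak_convergence unfolding JP .
  have "let w = (\<lambda>i::int. adjoint C (u i));
               B = adjoint_postcomp C A;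
               JB = resolvent_map B
           in
             (\<forall>wbar \<in> zer B.
                summable (\<lambda>k::nat. (w (int k) - JB (w (int k))) \<bullet> (JB (w (int k)) - wbar)) \<and>
                summable (\<lambda>k::nat. real k * (norm (w (int k) - JB (w (int k))))\<^sup>2) \<and>
                summable (\<lambda>k::nat. real k * (norm (w (int k) - w (int k - 1)))\<^sup>2)) \<and>
             (\<exists>wstar \<in> zer B.
                weakly_converges (\<lambda>k. JB (w (int k))) wstar \<and>
                (s = 1 \<longrightarrow> weakly_converges (\<lambda>k. w (int k)) wstar)) \<and>
             (\<forall>wbar \<in> zer B.
                (\<lambda>k::nat. (w (int k) - JB (w (int k))) \<bullet> (JB (w (int k)) - wbar))
                  \<in> o(\<lambda>k. 1 / real k) \<and>
                (\<lambda>k::nat. norm (w (int k) - w (int k - 1))) \<in> o(\<lambda>k. 1 / real k) \<and>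
                (\<lambda>k::nat. norm (w (int k) - JB (w (int k)))) \<in> o(\<lambda>k. 1 / real k)) \<and>
             weakly_converges (\<lambda>k. w (int k)) (adjoint C z)" (is "?decomposed C z")
    if "onto_decomposition M C" for C :: "'d \<Rightarrow> 'h"
  proof -
    interpret D: adjoint_factorisation A M C
      using that by unfold_locales
    have JB: "weakly_converges (\<lambda>k. adjoint C (J (u (int k)))) (adjoint C z)"
      using z(2) by (rule D.weakly_converges_adjoint)
    have "(\<lambda>k. (norm (adjoint C (u (int k) - J (u (int k)))))\<^sup>2) \<longlonglongrightarrow> 0"
      using F.fixpoint_exists F.residual_tendsto_zero
      unfolding JP D.M_inner_eq_adjoint power2_norm_eq_inner by blast
    then have res: "(\<lambda>k. adjoint C (u (int k) - J (u (int k)))) \<longlonglongrightarrow> 0"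
      by (simp add: tendsto_norm_zero_iff)
    have w: "weakly_converges (\<lambda>k. adjoint C (u (int k))) (adjoint C z)"
      unfolding weakly_converges_def
    proof
      fix y
      have "(\<lambda>k. adjoint C (u (int k) - J (u (int k))) \<bullet> y) \<longlonglongrightarrow> 0 \<bullet> y"
        by (intro tendsto_intros res)
      moreover have "(\<lambda>k. adjoint C (J (u (int k))) \<bullet> y) \<longlonglongrightarrow> adjoint C z \<bullet> y"
        using JB by (simp add: weakly_converges_def)
      ultimately have "(\<lambda>k. adjoint C (u (int k) - J (u (int k))) \<bullet> y + adjoint C (J (u (int k))) \<bullet> y)
          \<longlonglongrightarrow> 0 \<bullet> y + adjoint C z \<bullet> y"
        by (rule tendsto_add)
      then show "(\<lambda>k. adjoint C (u (int k)) \<bullet> y) \<longlonglongrightarrow> adjoint C z \<bullet> y"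
        by (simp add: D.adjoint_diff inner_diff_left)
    qed
    show ?thesis
      unfolding Let_def D.zer_postcomp D.resolvent_postcomp JP[symmetric]
        D.adjoint_diff[symmetric] D.M_seminorm_eq_adjoint[symmetric]
      using F.seminorm_sums F.seminorm_little_o z(1) JB w
      by (auto simp: JP D.adjoint_diff[symmetric] D.M_inner_eq_adjoint[symmetric])
  qed
  then have "\<forall>C :: 'd \<Rightarrow> 'h. closed (range M) \<and> onto_decomposition M C \<longrightarrow> ?decomposed C z"
    by simp
  moreover have "s = 1 \<longrightarrow> weakly_converges (\<lambda>k. u (int k)) z"
    using z(2) F.weak_convergence_of_iterates by (simp add: JP)
  ultimately show ?thesis
    using z F.seminorm_sums F.seminorm_little_o unfolding JP
    by (intro conjI ballI bexI[of _ z]) assumption+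
qed

end
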